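(* Let $N$ be a Poisson point process on a Polish space $\mathbb{X}$ with finite intensity measure $\Lambda$, and let $\mathcal{S}$ be a countable class of measurable functions from $\mathbb{X}$ to $[-1,1]$. For $s\in\mathcal{S}$ put $I(s)=\int_{\mathbb{X}} s(x)\,(\mathrm{d}N(x)-\mathrm{d}\Lambda(x))$, and let $Z=\sup_{s\in\mathcal{S}} I(s)$. Let $L_Z(t)=\log\mathbb{E}[\exp(tZ)]$, $V=\sup_{s\in\mathcal{S}}\operatorname{Var}(I(s))$ and $\upsilon=2\,\mathbb{E}Z+V$. Then: a) for any $t\ge 0$, $$L_Z(t)\le t\,\mathbb{E}Z+\frac t2\,(2\,\mathbb{E}Z+V)\left(\exp\big((e^{2t}-1)/2\big)-1\right);$$ b) for any $x\ge 0$, $$\mathbb{P}(Z\ge \mathbb{E}Z+x)\le \exp\left(-\frac x4\log\big(1+2\log(1+x/\upsilon)\big)\right);$$ c) for any $x\ge 0$, $$\mathbb{P}(Z\ge \mathbb{E}Z+x)\le \exp\left(-\frac{x^2}{\upsilon+\sqrt{\upsilon^2+3\upsilon x}+(3x/2)}\right)\le \exp\left(-\frac{x^2}{2\upsilon+3x}\right).$$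
   Context: $(\Omega,\mathcal{A},\mathbb{P})$ is the underlying probability space of $N$. A Poisson point process with intensity measure $\Lambda$ is viewed as a random $\mathbb{N}_0$-valued measure $N$, and $\int s\,\mathrm{d}N$ is the sum of the values of $s$ over the points of $N$. *)

theory Defs
  imports "HOL-Probability.Probability"
begin

text \<open>
  A Poisson point process with finite intensity measure \<open>\<Lambda>\<close> on a Polish space (carrying its Borel
  \<open>\<sigma>\<close>-algebra), defined on the probability space \<open>M\<close>. The realisations \<open>N \<omega>\<close> are measures whose values
  are natural numbers, hence finite. The weights of the Poisson distribution are written out because
  \<open>poisson_pmf\<close> excludes rate 0; here the convention \<open>0 ^ 0 = 1\<close> makes \<open>N \<omega> B = 0\<close> almost surely
  whenever \<open>\<Lambda> B = 0\<close>.
\<close>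

locale finite_poisson_point_process =
  prob_space M + intensity: finite_measure \<Lambda>
  for M :: "'w measure" and \<Lambda> :: "'x :: polish_space measure" +
  fixes N :: "'w \<Rightarrow> 'x measure"
  assumes sets_intensity: "sets \<Lambda> = sets borel"
    and sets_process: "\<And>\<omega>. \<omega> \<in> space M \<Longrightarrow> sets (N \<omega>) = sets borel"
    and nat_valued: "\<And>\<omega> B. \<omega> \<in> space M \<Longrightarrow> B \<in> sets borel \<Longrightarrow> \<exists>k::nat. emeasure (N \<omega>) B = of_nat k"
    and random_measure: "\<And>B. B \<in> sets borel \<Longrightarrow> (\<lambda>\<omega>. emeasure (N \<omega>) B) \<in> borel_measurable M"
    and poisson_distributed: "\<And>B (k::nat). B \<in> sets borel \<Longrightarrow>
      prob {\<omega> \<in> space M. emeasure (N \<omega>) B = of_nat k}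
        = measure \<Lambda> B ^ k / fact k * exp (- measure \<Lambda> B)"
    and independent_on_disjoint: "\<And>(B :: nat \<Rightarrow> 'x set) n.
      (\<And>i. i < n \<Longrightarrow> B i \<in> sets borel) \<Longrightarrow> disjoint_family_on B {..<n} \<Longrightarrow>
      indep_vars (\<lambda>_. borel) (\<lambda>i \<omega>. emeasure (N \<omega>) (B i)) {..<n}"

definition compensated_integral ::
  "'x measure \<Rightarrow> ('w \<Rightarrow> 'x measure) \<Rightarrow> ('x \<Rightarrow> real) \<Rightarrow> 'w \<Rightarrow> real" where
  "compensated_integral \<Lambda> N s \<omega> = (\<integral>x. s x \<partial>(N \<omega>)) - (\<integral>x. s x \<partial>\<Lambda>)"

end

theory Submission
  imports Defs "HOL-Real_Asymp.Real_Asymp"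
begin

text \<open>
  The proof is an instance of the entropy method. The supremum \<open>Z\<close> enters only through
  \<open>m t = E exp (t Z)\<close>, and the entropy of \<open>exp (t Z)\<close> is \<open>t m' t - m t ln (m t)\<close>. For a positive functional \<open>F\<close> of a
  Poisson process the entropy is at most the mean of the integral over \<open>x\<close>, with respect to the
  intensity, of the divergence of \<open>u ln u\<close> between \<open>F\<close> and \<open>F\<close> with a point added at \<open>x\<close>
  (\<open>entropy_poisson_le\<close>). Adding a point at \<open>x\<close> changes \<open>Z\<close> by an amount \<open>d\<close> between \<open>s x\<close> and 1, where \<open>s\<close>
  is the function that attains the supremum. An elementary inequality (\<open>jump_divergence_le\<close>) bounds the
  divergence by a combination of \<open>s\<^sup>2\<close>, \<open>- s\<close> and \<open>d exp (t d)\<close>. The first integrates to at most the maximal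
  variance \<open>V\<close>. The last becomes, by the Mecke formula, a sum over the points of the process of the
  losses caused by removing a point, hence at most the sum of \<open>s\<close> over the points; together with \<open>- s\<close>,
  which integrates to the compensator, this is \<open>Z\<close>. The outcome is a differential inequality for \<open>m\<close>,
  which integrates to the bound on \<open>ln (m t)\<close> (\<open>ln_le_of_entropy_differential_inequality\<close>). The
  tail estimates follow by Chernoff's inequality with suitable values of \<open>t\<close>.

  The process enters only through finite dimensional distributions. After rounding finitely many of the
  functions to finite ranges, \<open>Z\<close> is a maximum of linear statistics of independent Poisson counts
  (\<open>count_vector_distribution\<close>, \<open>ln_mgf_max_le\<close>); the error is controlled by the total mass, whose
  exponential moments are finite, and the bound passes to the limit
  (\<open>ln_mgf_sup_compensated_integral_le\<close>). For Poisson counts the entropy inequality is the limit of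
  the corresponding one for binomial counts, which follows from the case of a single coin by
  tensorisation of entropy (\<open>entropy_pair_pmf_le\<close>).
\<close>

section \<open>Entropy of binomial counts\<close>

definition entropy_pmf :: "'a pmf \<Rightarrow> ('a \<Rightarrow> real) \<Rightarrow> real" where
  "entropy_pmf p f = measure_pmf.expectation p (\<lambda>x. f x * ln (f x))
     - measure_pmf.expectation p f * ln (measure_pmf.expectation p f)"

text \<open>
  The Bregman divergence of the convex function \<open>x \<mapsto> x ln x\<close>: the amount by which \<open>v ln v\<close>
  exceeds the tangent at \<open>u\<close>.
\<close>

definition xlogx_divergence :: "real \<Rightarrow> real \<Rightarrow> real" where
  "xlogx_divergence u v = v * (ln v - ln u) - v + u"

lemma xlogx_divergence_nonneg:
  assumes "u > 0" "v > 0"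
  shows "xlogx_divergence u v \<ge> 0"
proof -
  have "ln (u / v) \<le> u / v - 1"
    using assms by (intro ln_le_minus_one) simp
  then have "v * ln (u / v) \<le> v * (u / v - 1)"
    using assms by (intro mult_left_mono) auto
  then show ?thesis
    using assms by (simp add: xlogx_divergence_def ln_div algebra_simps)
qed

lemma integrable_finite_pmf:
  fixes f :: "'a \<Rightarrow> real"
  assumes "finite (set_pmf p)"
  shows "integrable (measure_pmf p) f"
  using assms by (rule integrable_measure_pmf_finite)

lemma expectation_pmf_pos:
  fixes f :: "'a \<Rightarrow> real"
  assumes "finite (set_pmf p)" "\<And>x. f x > 0"
  shows "measure_pmf.expectation p f > 0"
proof -
  have "measure_pmf.expectation p f = (\<Sum>x\<in>set_pmf p. pmf p x * f x)"
    using assms by (subst integral_measure_pmf[of "set_pmf p"]) (auto simp: mult.commute)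
  also have "\<dots> > 0"
    using assms by (intro sum_pos) (auto simp: pmf_positive set_pmf_not_empty)
  finally show ?thesis .
qed

lemma expectation_pair_pmf_sum:
  fixes G :: "'a \<times> 'b \<Rightarrow> real"
  assumes p: "finite (set_pmf p)" and q: "finite (set_pmf q)"
  shows "measure_pmf.expectation (pair_pmf p q) G =
    (\<Sum>x\<in>set_pmf p. \<Sum>y\<in>set_pmf q. pmf p x * pmf q y * G (x, y))"
proof -
  have "measure_pmf.expectation (pair_pmf p q) G
      = (\<Sum>z\<in>set_pmf p \<times> set_pmf q. G z * pmf (pair_pmf p q) z)"
    using assms by (intro integral_measure_pmf_real) auto
  also have "\<dots> = (\<Sum>x\<in>set_pmf p. \<Sum>y\<in>set_pmf q. pmf p x * pmf q y * G (x, y))"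
    by (subst sum.cartesian_product) (auto intro!: sum.cong simp: pmf_pair mult_ac)
  finally show ?thesis .
qed

lemma expectation_pair_pmf_iterated:
  fixes G :: "'a \<times> 'b \<Rightarrow> real"
  assumes p: "finite (set_pmf p)" and q: "finite (set_pmf q)"
  shows "measure_pmf.expectation (pair_pmf p q) G =
      measure_pmf.expectation p (\<lambda>x. measure_pmf.expectation q (\<lambda>y. G (x, y)))"
    and "measure_pmf.expectation (pair_pmf p q) G =
      measure_pmf.expectation q (\<lambda>y. measure_pmf.expectation p (\<lambda>x. G (x, y)))"
proof -
  have P: "measure_pmf.expectation p f = (\<Sum>x\<in>set_pmf p. pmf p x * f x)" for f :: "'a \<Rightarrow> real"
    using p by (subst integral_measure_pmf_real[of "set_pmf p"]) (auto simp: mult.commute)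
  have Q: "measure_pmf.expectation q f = (\<Sum>y\<in>set_pmf q. pmf q y * f y)" for f :: "'b \<Rightarrow> real"
    using q by (subst integral_measure_pmf_real[of "set_pmf q"]) (auto simp: mult.commute)
  show "measure_pmf.expectation (pair_pmf p q) G =
      measure_pmf.expectation p (\<lambda>x. measure_pmf.expectation q (\<lambda>y. G (x, y)))"
    unfolding P Q expectation_pair_pmf_sum[OF p q] by (simp add: sum_distrib_left mult.assoc)
  show "measure_pmf.expectation (pair_pmf p q) G =
      measure_pmf.expectation q (\<lambda>y. measure_pmf.expectation p (\<lambda>x. G (x, y)))"
    unfolding P Q expectation_pair_pmf_sum[OF p q]
    by (subst sum.swap) (simp add: sum_distrib_left mult_ac)
qed

text \<open>
  Tensorisation of entropy. With \<open>g\<close> and \<open>h\<close> the two marginal averages of \<open>G\<close> and \<open>m\<close> its mean, the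
  difference of the two sides is the mean of \<open>G ln (G m / (g h))\<close>, a mutual information; it is
  nonnegative because \<open>ln x \<ge> 1 - 1 / x\<close> and \<open>G\<close> and \<open>g h / m\<close> have the same mean. Finite support
  frees the argument from integrability conditions.
\<close>

lemma entropy_pair_pmf_le:
  fixes G :: "'a \<times> 'b \<Rightarrow> real"
  assumes p: "finite (set_pmf p)" and q: "finite (set_pmf q)" and pos: "\<And>z. G z > 0"
  shows "entropy_pmf (pair_pmf p q) G \<le>
    measure_pmf.expectation p (\<lambda>x. entropy_pmf q (\<lambda>y. G (x, y))) +
    measure_pmf.expectation q (\<lambda>y. entropy_pmf p (\<lambda>x. G (x, y)))"
proof -
  note [simp] = integrable_finite_pmf[OF p] integrable_finite_pmf[OF q]
  have pq: "finite (set_pmf (pair_pmf p q))"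
    using p q by simp
  note [simp] = integrable_finite_pmf[OF pq]
  define g where "g = (\<lambda>x. measure_pmf.expectation q (\<lambda>y. G (x, y)))"
  define h where "h = (\<lambda>y. measure_pmf.expectation p (\<lambda>x. G (x, y)))"
  define m where "m = measure_pmf.expectation (pair_pmf p q) G"
  have gpos: "g x > 0" for x
    unfolding g_def by (intro expectation_pmf_pos q pos)
  have hpos: "h x > 0" for x
    unfolding h_def by (intro expectation_pmf_pos p pos)
  have mpos: "m > 0"
    unfolding m_def by (intro expectation_pmf_pos pq pos)
  have mg: "m = measure_pmf.expectation p g" and mh: "m = measure_pmf.expectation q h"
    unfolding m_def g_def h_def by (fact expectation_pair_pmf_iterated[OF p q])+
  define H where "H = measure_pmf.expectation (pair_pmf p q) (\<lambda>z. G z * ln (G z))"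
  have 1: "measure_pmf.expectation p (\<lambda>x. entropy_pmf q (\<lambda>y. G (x, y)))
      = H - measure_pmf.expectation p (\<lambda>x. g x * ln (g x))"
    unfolding entropy_pmf_def H_def expectation_pair_pmf_iterated(1)[OF p q] g_def by simp
  have 2: "measure_pmf.expectation q (\<lambda>y. entropy_pmf p (\<lambda>x. G (x, y)))
      = H - measure_pmf.expectation q (\<lambda>y. h y * ln (h y))"
    unfolding entropy_pmf_def H_def expectation_pair_pmf_iterated(2)[OF p q] h_def by simp
  have 3: "measure_pmf.expectation (pair_pmf p q) (\<lambda>z. G z * ln (g (fst z)))
      = measure_pmf.expectation p (\<lambda>x. g x * ln (g x))"
    unfolding expectation_pair_pmf_iterated(1)[OF p q] by (simp add: g_def)
  have 4: "measure_pmf.expectation (pair_pmf p q) (\<lambda>z. G z * ln (h (snd z)))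
      = measure_pmf.expectation q (\<lambda>y. h y * ln (h y))"
    unfolding expectation_pair_pmf_iterated(2)[OF p q] by (simp add: h_def)
  have 5: "measure_pmf.expectation (pair_pmf p q) (\<lambda>z. g (fst z) * h (snd z) / m) = m"
    unfolding expectation_pair_pmf_iterated(1)[OF p q] using mpos
    by (simp flip: mg mh)
  have "G z - g (fst z) * h (snd z) / m
      \<le> G z * ln (G z) + G z * ln m - G z * ln (g (fst z)) - G z * ln (h (snd z))" for z
  proof -
    have "ln (g (fst z) * h (snd z) / (m * G z)) \<le> g (fst z) * h (snd z) / (m * G z) - 1"
      using pos[of z] gpos[of "fst z"] hpos[of "snd z"] mpos by (intro ln_le_minus_one) simp
    then have "G z * ln (g (fst z) * h (snd z) / (m * G z))
        \<le> G z * (g (fst z) * h (snd z) / (m * G z) - 1)"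
      using pos[of z] by (intro mult_left_mono) auto
    also have "\<dots> = g (fst z) * h (snd z) / m - G z"
      using pos[of z] mpos by (simp add: field_simps)
    also have "ln (g (fst z) * h (snd z) / (m * G z))
        = ln (g (fst z)) + ln (h (snd z)) - ln m - ln (G z)"
      using pos[of z] gpos[of "fst z"] hpos[of "snd z"] mpos by (simp add: ln_div ln_mult)
    finally show ?thesis
      by (simp add: algebra_simps)
  qed
  then have "measure_pmf.expectation (pair_pmf p q) (\<lambda>z. G z - g (fst z) * h (snd z) / m)
      \<le> measure_pmf.expectation (pair_pmf p q)
          (\<lambda>z. G z * ln (G z) + G z * ln m - G z * ln (g (fst z)) - G z * ln (h (snd z)))"
    by (intro integral_mono) auto
  then have "0 \<le> H + m * ln m - measure_pmf.expectation p (\<lambda>x. g x * ln (g x))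
      - measure_pmf.expectation q (\<lambda>y. h y * ln (h y))"
    using 5 by (simp add: 3 4 H_def m_def[symmetric])
  then show ?thesis
    unfolding 1 2 by (simp add: entropy_pmf_def H_def m_def)
qed

text \<open>
  Replacing \<open>m ln m\<close>, for the mean \<open>m\<close>, by its tangent at \<open>f False\<close> can only increase the entropy,
  and turns it into \<open>p\<close> times the divergence.
\<close>

lemma entropy_bernoulli_pmf_le:
  fixes f :: "bool \<Rightarrow> real"
  assumes p: "0 \<le> p" "p < 1" and pos: "\<And>b. f b > 0"
  shows "entropy_pmf (bernoulli_pmf p) f \<le> p * xlogx_divergence (f False) (f True)"
proof -
  define m where "m = p * f True + (1 - p) * f False"
  have m: "m > 0"
    using p pos[of True] pos[of False] by (simp add: m_def add_nonneg_pos)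
  have "ln (f False / m) \<le> f False / m - 1"
    using m pos by (intro ln_le_minus_one) simp
  then have "m * ln (f False / m) \<le> m * (f False / m - 1)"
    using m by (intro mult_left_mono) auto
  then have "m * (ln (f False) - ln m) \<le> f False - m"
    using m pos[of False] by (simp add: ln_div algebra_simps)
  then show ?thesis
    using p by (simp add: entropy_pmf_def xlogx_divergence_def m_def algebra_simps)
qed

lemma binomial_pmf_Suc_pair:
  assumes "p \<in> {0..1}"
  shows "binomial_pmf (Suc n) p =
    map_pmf (\<lambda>(b, k). (if b then 1 else 0) + k) (pair_pmf (bernoulli_pmf p) (binomial_pmf n p))"
  using assms
  by (simp add: binomial_pmf_Suc pair_pmf_def map_pmf_def bind_assoc_pmf bind_return_pmf)

lemma entropy_map_pmf:
  "entropy_pmf (map_pmf h p) f = entropy_pmf p (\<lambda>x. f (h x))"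
  by (simp add: entropy_pmf_def)

text \<open>
  A modified logarithmic Sobolev inequality, obtained by splitting off one coin after the other. The
  constant \<open>n p / (1 - p)\<close> tends to \<open>l\<close> when \<open>p = l / n\<close> and \<open>n\<close> grows; this is how the Poisson
  inequality arises. The factor \<open>1 / (1 - p)\<close> pays for averaging the divergence over the coin as well,
  whereas the Bernoulli bound only uses the outcome \<open>False\<close>.
\<close>

lemma entropy_binomial_pmf_le:
  fixes f :: "nat \<Rightarrow> real"
  assumes p: "0 \<le> p" "p < 1" and pos: "\<And>k. f k > 0"
  shows "entropy_pmf (binomial_pmf n p) f \<le> real n * p / (1 - p) *
    measure_pmf.expectation (binomial_pmf n p) (\<lambda>k. xlogx_divergence (f k) (f (Suc k)))"
  using pos
proof (induction n arbitrary: f)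
  case 0
  then show ?case
    using p by (simp add: binomial_pmf_0 entropy_pmf_def)
next
  case (Suc n)
  note pos = Suc.prems
  have p': "p \<in> {0..1}"
    using p by auto
  have fin: "finite (set_pmf (bernoulli_pmf p))" "finite (set_pmf (binomial_pmf n p))"
    using p by (auto intro: finite_set_pmf_binomial_pmf)
  note [simp] = integrable_finite_pmf[OF fin(1)] integrable_finite_pmf[OF fin(2)]
  define J where "J = (\<lambda>k. xlogx_divergence (f k) (f (Suc k)))"
  have Jnn: "J k \<ge> 0" for k
    unfolding J_def by (intro xlogx_divergence_nonneg pos)
  define s :: "bool \<Rightarrow> nat" where "s = (\<lambda>b. if b then 1 else 0)"
  define EJ where "EJ = measure_pmf.expectation (binomial_pmf (Suc n) p) J"
  have EJ: "EJ = measure_pmf.expectation (bernoulli_pmf p) (\<lambda>b.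
      measure_pmf.expectation (binomial_pmf n p) (\<lambda>k. J (s b + k)))"
    and EJ': "EJ = measure_pmf.expectation (binomial_pmf n p) (\<lambda>k.
      measure_pmf.expectation (bernoulli_pmf p) (\<lambda>b. J (s b + k)))"
    unfolding EJ_def binomial_pmf_Suc_pair[OF p'] s_def integral_map_pmf
    using expectation_pair_pmf_iterated[OF fin, of "\<lambda>(b, k). J ((if b then 1 else 0) + k)"]
    by (simp_all add: case_prod_beta')
  have "entropy_pmf (binomial_pmf (Suc n) p) f
      \<le> measure_pmf.expectation (bernoulli_pmf p) (\<lambda>b. entropy_pmf (binomial_pmf n p) (\<lambda>k. f (s b + k)))
      + measure_pmf.expectation (binomial_pmf n p) (\<lambda>k. entropy_pmf (bernoulli_pmf p) (\<lambda>b. f (s b + k)))"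
    unfolding binomial_pmf_Suc_pair[OF p'] entropy_map_pmf
    using entropy_pair_pmf_le[OF fin, of "\<lambda>(b, k). f (s b + k)"] pos
    by (simp add: case_prod_beta' s_def)
  also have "measure_pmf.expectation (bernoulli_pmf p)
      (\<lambda>b. entropy_pmf (binomial_pmf n p) (\<lambda>k. f (s b + k)))
      \<le> measure_pmf.expectation (bernoulli_pmf p) (\<lambda>b. real n * p / (1 - p) *
          measure_pmf.expectation (binomial_pmf n p) (\<lambda>k. J (s b + k)))"
    using Suc.IH[of "\<lambda>k. f (s b + k)" for b] pos
    by (intro integral_mono) (auto simp: J_def)
  also have "\<dots> = real n * p / (1 - p) * EJ"
    unfolding EJ by simp
  also have "measure_pmf.expectation (binomial_pmf n p) (\<lambda>k. entropy_pmf (bernoulli_pmf p) (\<lambda>b. f (s b + k)))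
     \<le> measure_pmf.expectation (binomial_pmf n p) (\<lambda>k. p / (1 - p) *
          measure_pmf.expectation (bernoulli_pmf p) (\<lambda>b. J (s b + k)))"
  proof (intro integral_mono)
    fix k
    have "entropy_pmf (bernoulli_pmf p) (\<lambda>b. f (s b + k)) \<le> p * J k"
      using entropy_bernoulli_pmf_le[OF p, of "\<lambda>b. f (s b + k)"] pos by (simp add: J_def s_def)
    also have "\<dots> = p / (1 - p) * ((1 - p) * J k)"
      using p by simp
    also have "\<dots> \<le> p / (1 - p) * measure_pmf.expectation (bernoulli_pmf p) (\<lambda>b. J (s b + k))"
      using p Jnn by (intro mult_left_mono) (auto simp: s_def)
    finally show "entropy_pmf (bernoulli_pmf p) (\<lambda>b. f (s b + k))
      \<le> p / (1 - p) * measure_pmf.expectation (bernoulli_pmf p) (\<lambda>b. J (s b + k))" .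
  qed auto
  also have "\<dots> = p / (1 - p) * EJ"
    unfolding EJ' by simp
  also have "real n * p / (1 - p) * EJ + p / (1 - p) * EJ = real (Suc n) * p / (1 - p) * EJ"
    by (simp add: algebra_simps add_divide_distrib)
  finally show ?case
    unfolding EJ_def J_def by simp
qed

lemma entropy_Pi_binomial_pmf_le:
  fixes f :: "('i \<Rightarrow> nat) \<Rightarrow> real"
  assumes "finite A" and p: "\<And>j. j \<in> A \<Longrightarrow> 0 \<le> p j" "\<And>j. j \<in> A \<Longrightarrow> p j < 1"
    and pos: "\<And>k. f k > 0"
  shows "entropy_pmf (Pi_pmf A 0 (\<lambda>j. binomial_pmf n (p j))) f \<le>
    (\<Sum>j\<in>A. real n * p j / (1 - p j) * measure_pmf.expectation (Pi_pmf A 0 (\<lambda>j. binomial_pmf n (p j)))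
      (\<lambda>k. xlogx_divergence (f k) (f (k(j := Suc (k j))))))"
  using assms
proof (induction A arbitrary: f)
  case empty
  then show ?case
    by (simp add: entropy_pmf_def)
next
  case (insert i A)
  note pos = insert.prems(3)
  let ?b = "\<lambda>j. binomial_pmf n (p j)"
  define P where "P = Pi_pmf A 0 ?b"
  define w where "w = (\<lambda>j. real n * p j / (1 - p j))"
  have fin: "finite (set_pmf (?b i))" "finite (set_pmf P)"
    using insert unfolding P_def by (auto simp: set_Pi_pmf intro!: finite_PiE_dflt finite_set_pmf_binomial_pmf
        less_imp_le)
  note [simp] = integrable_finite_pmf[OF fin(1)] integrable_finite_pmf[OF fin(2)]
  define J where "J = (\<lambda>j k. xlogx_divergence (f k) (f (k(j := Suc (k j)))))"
  have ins: "Pi_pmf (insert i A) 0 ?b = map_pmf (\<lambda>z. (snd z)(i := fst z)) (pair_pmf (?b i) P)"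
    using insert unfolding P_def by (subst Pi_pmf_insert) (auto simp: case_prod_beta')
  define EJ where "EJ = (\<lambda>j. measure_pmf.expectation (Pi_pmf (insert i A) 0 ?b) (J j))"
  have EJ: "EJ j = measure_pmf.expectation (?b i) (\<lambda>y. measure_pmf.expectation P (\<lambda>k. J j (k(i := y))))"
    and EJ': "EJ j = measure_pmf.expectation P (\<lambda>k. measure_pmf.expectation (?b i) (\<lambda>y. J j (k(i := y))))" for j
    unfolding EJ_def ins integral_map_pmf
    using expectation_pair_pmf_iterated[OF fin, of "\<lambda>z. J j ((snd z)(i := fst z))"] by simp_all
  have "entropy_pmf (Pi_pmf (insert i A) 0 ?b) f
      \<le> measure_pmf.expectation (?b i) (\<lambda>y. entropy_pmf P (\<lambda>k. f (k(i := y))))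
      + measure_pmf.expectation P (\<lambda>k. entropy_pmf (?b i) (\<lambda>y. f (k(i := y))))"
    unfolding ins entropy_map_pmf
    using entropy_pair_pmf_le[OF fin, of "\<lambda>z. f ((snd z)(i := fst z))"] pos by simp
  also have "measure_pmf.expectation (?b i) (\<lambda>y. entropy_pmf P (\<lambda>k. f (k(i := y))))
      \<le> measure_pmf.expectation (?b i) (\<lambda>y. \<Sum>j\<in>A. w j * measure_pmf.expectation P (\<lambda>k. J j (k(i := y))))"
  proof (intro integral_mono)
    fix y
    have "entropy_pmf P (\<lambda>k. f (k(i := y))) \<le> (\<Sum>j\<in>A. w j * measure_pmf.expectation P
        (\<lambda>k. xlogx_divergence (f (k(i := y))) (f ((k(j := Suc (k j)))(i := y)))))"
      using insert unfolding P_def w_def by (intro insert.IH) auto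
    also have "\<dots> = (\<Sum>j\<in>A. w j * measure_pmf.expectation P (\<lambda>k. J j (k(i := y))))"
    proof (intro sum.cong refl arg_cong2[of _ _ _ _ "(*)"] Bochner_Integration.integral_cong)
      fix j k assume "j \<in> A"
      then have "j \<noteq> i"
        using insert by auto
      then show "xlogx_divergence (f (k(i := y))) (f ((k(j := Suc (k j)))(i := y))) = J j (k(i := y))"
        by (simp add: J_def fun_upd_twist)
    qed
    finally show "entropy_pmf P (\<lambda>k. f (k(i := y)))
      \<le> (\<Sum>j\<in>A. w j * measure_pmf.expectation P (\<lambda>k. J j (k(i := y))))" .
  qed auto
  also have "\<dots> = (\<Sum>j\<in>A. w j * EJ j)"
    by (simp add: EJ)
  also have "measure_pmf.expectation P (\<lambda>k. entropy_pmf (?b i) (\<lambda>y. f (k(i := y))))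
      \<le> measure_pmf.expectation P (\<lambda>k. w i * measure_pmf.expectation (?b i) (\<lambda>y. J i (k(i := y))))"
  proof (intro integral_mono)
    fix k
    show "entropy_pmf (?b i) (\<lambda>y. f (k(i := y))) \<le> w i * measure_pmf.expectation (?b i) (\<lambda>y. J i (k(i := y)))"
      using entropy_binomial_pmf_le[of "p i" "\<lambda>y. f (k(i := y))" n] insert.prems
      by (simp add: J_def w_def)
  qed auto
  also have "\<dots> = w i * EJ i"
    by (simp add: EJ')
  also have "(\<Sum>j\<in>A. w j * EJ j) + w i * EJ i = (\<Sum>j\<in>insert i A. w j * EJ j)"
    using insert by simp
  finally have "entropy_pmf (Pi_pmf (insert i A) 0 ?b) f \<le> (\<Sum>j\<in>insert i A. w j * EJ j)"
    by simp
  then show ?case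
    unfolding EJ_def J_def w_def .
qed

section \<open>Poisson vectors as limits of binomial vectors\<close>

text \<open>
  The density of the binomial distribution with parameters \<open>n\<close> and \<open>l / n\<close> with respect to the Poisson
  distribution of rate \<open>l\<close>, in a form that makes sense for \<open>l = 0\<close> too. It is bounded by \<open>exp l\<close> and
  tends to 1, so that binomial expectations of every Poisson-integrable function converge to the Poisson
  expectation by dominated convergence.
\<close>

definition binomial_poisson_ratio :: "real \<Rightarrow> nat \<Rightarrow> nat \<Rightarrow> real" where
  "binomial_poisson_ratio l n k =
    (if k \<le> n then fact n / (fact (n - k) * real n ^ k) * (1 - l / real n) ^ (n - k) * exp l else 0)"

lemma pmf_binomial_eq_poisson_times_ratio:
  assumes "0 \<le> l" "l < real n"
  shows "pmf (binomial_pmf n (l / real n)) k =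
    l ^ k / fact k * exp (- l) * binomial_poisson_ratio l n k"
proof (cases "k \<le> n")
  case True
  then show ?thesis
    using assms by (simp add: binomial_poisson_ratio_def binomial_fact power_divide exp_minus field_simps)
next
  case False
  then show ?thesis
    using assms by (simp add: binomial_poisson_ratio_def)
qed

lemma binomial_poisson_ratio_bounds:
  assumes "0 \<le> l" "l < real n"
  shows "0 \<le> binomial_poisson_ratio l n k" "binomial_poisson_ratio l n k \<le> exp l"
proof -
  show "0 \<le> binomial_poisson_ratio l n k"
    using assms by (auto simp: binomial_poisson_ratio_def)
  show "binomial_poisson_ratio l n k \<le> exp l"
  proof (cases "k \<le> n")
    case True
    have "fact n div fact (n - k) \<le> n ^ k"
      using True by (rule fact_div_fact_le_pow)
    then have "real (fact n div fact (n - k)) \<le> real n ^ k"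
      by (metis of_nat_le_iff of_nat_power)
    moreover have "real (fact n div fact (n - k)) = fact n / fact (n - k)"
      using fact_dvd[of "n - k" n, where ?'a = nat] by (simp add: real_of_nat_div)
    ultimately have 1: "fact n / (fact (n - k) * real n ^ k) \<le> (1::real)"
      using assms by (simp add: field_simps)
    have 2: "(1 - l / real n) ^ (n - k) \<le> 1"
      using assms by (intro power_le_one) (auto simp: field_simps)
    have "fact n / (fact (n - k) * real n ^ k) * (1 - l / real n) ^ (n - k) * exp l \<le> 1 * 1 * exp l"
      using assms by (intro mult_right_mono mult_mono 1 2) auto
    then show ?thesis
      using True by (simp add: binomial_poisson_ratio_def)
  qed (simp add: binomial_poisson_ratio_def)
qed

lemma falling_factorial_over_power_tendsto_1:
  "(\<lambda>n. fact n / (fact (n - k) * real n ^ k)) \<longlonglongrightarrow> (1::real)"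
proof (induction k)
  case 0
  then show ?case by simp
next
  case (Suc k)
  have "(\<lambda>n. 1 - real k / real n) \<longlonglongrightarrow> 1 - 0"
    by (intro tendsto_diff tendsto_const lim_const_over_n)
  from tendsto_mult[OF Suc this]
  have "(\<lambda>n. fact n / (fact (n - k) * real n ^ k) * (1 - real k / real n)) \<longlonglongrightarrow> 1"
    by simp
  moreover have "\<forall>\<^sub>F n in sequentially. fact n / (fact (n - k) * real n ^ k) * (1 - real k / real n)
      = fact n / (fact (n - Suc k) * real n ^ Suc k)"
    using eventually_gt_at_top[of k]
  proof eventually_elim
    case (elim n)
    have "fact (n - k) = real (n - k) * fact (n - Suc k)"
      using elim by (metis Suc_diff_Suc fact_Suc of_nat_fact of_nat_mult)
    moreover have "1 - real k / real n = real (n - k) / real n" "real (n - k) \<noteq> 0"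
      using elim by (simp_all add: field_simps of_nat_diff)
    ultimately show ?case
      by (simp add: mult_ac)
  qed
  ultimately show ?case
    by (rule Lim_transform_eventually)
qed

lemma binomial_poisson_ratio_tendsto_1:
  "(\<lambda>n. binomial_poisson_ratio l n k) \<longlonglongrightarrow> 1"
proof -
  have "(\<lambda>n. (1 + (- l) / real n) ^ n / (1 - l / real n) ^ k) \<longlonglongrightarrow> exp (- l) / (1 - 0) ^ k"
    by (intro tendsto_divide tendsto_power tendsto_diff tendsto_const lim_const_over_n
        tendsto_exp_limit_sequentially) simp
  then have "(\<lambda>n. fact n / (fact (n - k) * real n ^ k) *
      ((1 + (- l) / real n) ^ n / (1 - l / real n) ^ k) * exp l) \<longlonglongrightarrow> 1 * (exp (- l) / (1 - 0) ^ k) * exp l"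
    by (intro tendsto_mult falling_factorial_over_power_tendsto_1 tendsto_const)
  moreover have "\<forall>\<^sub>F n in sequentially. fact n / (fact (n - k) * real n ^ k) *
      ((1 + (- l) / real n) ^ n / (1 - l / real n) ^ k) * exp l = binomial_poisson_ratio l n k"
    using eventually_gt_at_top[of k] eventually_gt_at_top[of "nat \<lceil>\<bar>l\<bar>\<rceil>"]
  proof eventually_elim
    case (elim n)
    then have "l < real n"
      by linarith
    then have "1 - l / real n \<noteq> 0"
      using elim by (simp add: field_simps)
    then have "(1 + (- l) / real n) ^ n / (1 - l / real n) ^ k = (1 - l / real n) ^ (n - k)"
      using elim by (simp add: power_diff)
    then show ?case
      using elim by (simp add: binomial_poisson_ratio_def)
  qed
  ultimately have "(\<lambda>n. binomial_poisson_ratio l n k) \<longlonglongrightarrow> 1 * (exp (- l) / (1 - 0) ^ k) * exp l"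
    by (rule Lim_transform_eventually)
  then show ?thesis
    by (simp add: exp_minus)
qed

lemma expectation_pmf_eq_count_space:
  fixes f :: "'a \<Rightarrow> real"
  shows "measure_pmf.expectation p f = (\<integral>x. pmf p x * f x \<partial>count_space UNIV)"
  unfolding measure_pmf_eq_density by (subst integral_density) auto

text \<open>
  Independent Poisson counts with rates \<open>\<rho> j\<close>, as a distribution on functions that vanish outside the
  index set. The weights are written out so that a rate may be 0. The finiteness of the exponential
  moments is kept as an assumption because, for the counts of a point process, it is read off from the
  Poisson distribution of the total mass.
\<close>

locale poisson_vector =
  fixes \<mu> :: "('i \<Rightarrow> nat) pmf" and A :: "'i set" and \<rho> :: "'i \<Rightarrow> real"
  assumes finite_index: "finite A"
    and rate_nonneg: "\<And>j. j \<in> A \<Longrightarrow> 0 \<le> \<rho> j"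
    and pmf_poisson_vector: "\<And>k. pmf \<mu> k =
      (if \<forall>j. j \<notin> A \<longrightarrow> k j = 0 then \<Prod>j\<in>A. \<rho> j ^ k j / fact (k j) * exp (- \<rho> j) else 0)"
    and exp_moments: "\<And>c. integrable (measure_pmf \<mu>) (\<lambda>k. exp (c * (\<Sum>j\<in>A. real (k j))))"
begin

lemma pmf_inside:
  assumes "\<And>j. j \<notin> A \<Longrightarrow> k j = 0"
  shows "pmf \<mu> k = (\<Prod>j\<in>A. \<rho> j ^ k j / fact (k j) * exp (- \<rho> j))"
  using assms unfolding pmf_poisson_vector by (intro if_P) auto

lemma pmf_outside:
  assumes "j \<notin> A" "k j \<noteq> 0"
  shows "pmf \<mu> k = 0"
  using assms unfolding pmf_poisson_vector by (intro if_not_P) auto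

definition binomial_vector :: "nat \<Rightarrow> ('i \<Rightarrow> nat) pmf" where
  "binomial_vector n = Pi_pmf A 0 (\<lambda>j. binomial_pmf n (\<rho> j / real n))"

lemma eventually_rate_less: "\<forall>\<^sub>F n in sequentially. \<forall>j\<in>A. \<rho> j < real n"
  by (intro eventually_ball_finite finite_index ballI) real_asymp

lemma expectation_binomial_vector_tendsto:
  assumes f: "integrable (measure_pmf \<mu>) f"
  shows "(\<lambda>n. measure_pmf.expectation (binomial_vector n) f) \<longlonglongrightarrow> measure_pmf.expectation \<mu> (f :: _ \<Rightarrow> real)"
proof -
  define R where "R = (\<lambda>n k. \<Prod>j\<in>A. binomial_poisson_ratio (\<rho> j) n (k j))"
  obtain n0 where n0: "\<And>n j. n \<ge> n0 \<Longrightarrow> j \<in> A \<Longrightarrow> \<rho> j < real n"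
    using eventually_rate_less by (auto simp: eventually_sequentially)
  have "pmf (binomial_vector n) k = pmf \<mu> k * R n k" if "n \<ge> n0" for n k
    unfolding binomial_vector_def
  proof (cases "\<forall>j. j \<notin> A \<longrightarrow> k j = 0")
    case True
    then have "pmf (Pi_pmf A 0 (\<lambda>j. binomial_pmf n (\<rho> j / real n))) k
        = (\<Prod>j\<in>A. \<rho> j ^ k j / fact (k j) * exp (- \<rho> j) * binomial_poisson_ratio (\<rho> j) n (k j))"
      using n0[OF that] rate_nonneg
      by (subst pmf_Pi'[OF finite_index])
         (simp_all add: pmf_binomial_eq_poisson_times_ratio del: pmf_binomial)
    then show "pmf (Pi_pmf A 0 (\<lambda>j. binomial_pmf n (\<rho> j / real n))) k = pmf \<mu> k * R n k"
      using True by (simp add: pmf_inside R_def flip: prod.distrib)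
  next
    case False
    then show "pmf (Pi_pmf A 0 (\<lambda>j. binomial_pmf n (\<rho> j / real n))) k = pmf \<mu> k * R n k"
      using pmf_outside[of _ k] by (auto simp: pmf_Pi_outside[OF finite_index])
  qed
  then have eq: "measure_pmf.expectation (binomial_vector n) f
      = measure_pmf.expectation \<mu> (\<lambda>k. f k * R n k)" if "n \<ge> n0" for n
    using that by (simp add: expectation_pmf_eq_count_space mult_ac)
  have "(\<lambda>n. measure_pmf.expectation \<mu> (\<lambda>k. f k * R (n + n0) k)) \<longlonglongrightarrow> measure_pmf.expectation \<mu> (\<lambda>k. f k * 1)"
  proof (rule integral_dominated_convergence[where w = "\<lambda>k. \<bar>f k\<bar> * exp (\<Sum>j\<in>A. \<rho> j)"])
    show "AE k in \<mu>. (\<lambda>n. f k * R (n + n0) k) \<longlonglongrightarrow> f k * 1"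
    proof (intro AE_I2 tendsto_mult tendsto_const)
      fix k
      have "(\<lambda>n. R n k) \<longlonglongrightarrow> (\<Prod>j\<in>A. 1)"
        unfolding R_def by (intro tendsto_prod binomial_poisson_ratio_tendsto_1)
      then show "(\<lambda>n. R (n + n0) k) \<longlonglongrightarrow> 1"
        by (intro LIMSEQ_ignore_initial_segment) simp
    qed
    show "AE k in \<mu>. norm (f k * R (n + n0) k) \<le> \<bar>f k\<bar> * exp (\<Sum>j\<in>A. \<rho> j)" for n
    proof (intro AE_I2)
      fix k
      have "0 \<le> R (n + n0) k"
        unfolding R_def using n0[of "n + n0"] rate_nonneg
        by (intro prod_nonneg binomial_poisson_ratio_bounds) auto
      moreover have "R (n + n0) k \<le> (\<Prod>j\<in>A. exp (\<rho> j))"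
        unfolding R_def using n0[of "n + n0"] rate_nonneg
        by (intro prod_mono conjI binomial_poisson_ratio_bounds) auto
      ultimately show "norm (f k * R (n + n0) k) \<le> \<bar>f k\<bar> * exp (\<Sum>j\<in>A. \<rho> j)"
        by (simp add: abs_mult exp_sum finite_index mult_left_mono)
    qed
  qed (use f in auto)
  then have "(\<lambda>n. measure_pmf.expectation (binomial_vector (n + n0)) f) \<longlonglongrightarrow> measure_pmf.expectation \<mu> f"
    by (simp add: eq)
  then show ?thesis
    by (rule LIMSEQ_offset)
qed

text \<open>
  The modified logarithmic Sobolev inequality for Poisson vectors: the limit of the inequality for
  vectors of independent binomial counts.
\<close>

theorem entropy_poisson_le:
  assumes pos: "\<And>k. f k > 0"
    and f: "integrable (measure_pmf \<mu>) f" "integrable (measure_pmf \<mu>) (\<lambda>k. f k * ln (f k))"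
    and J: "\<And>j. j \<in> A \<Longrightarrow>
      integrable (measure_pmf \<mu>) (\<lambda>k. xlogx_divergence (f k) (f (k(j := Suc (k j)))))"
  shows "entropy_pmf \<mu> f \<le> (\<Sum>j\<in>A. \<rho> j *
    measure_pmf.expectation \<mu> (\<lambda>k. xlogx_divergence (f k) (f (k(j := Suc (k j))))))"
proof (rule tendsto_le[OF sequentially_bot])
  have "measure_pmf.expectation \<mu> f > 0"
    by (intro measure_pmf.expectation_greater f AE_I2 pos)
  then show "(\<lambda>n. entropy_pmf (binomial_vector n) f) \<longlonglongrightarrow> entropy_pmf \<mu> f"
    unfolding entropy_pmf_def
    by (intro tendsto_diff tendsto_mult tendsto_ln expectation_binomial_vector_tendsto f) auto
  have w: "(\<lambda>n. real n * (l / real n) / (1 - l / real n)) \<longlonglongrightarrow> l" for l :: real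
    by real_asymp
  show "(\<lambda>n. \<Sum>j\<in>A. real n * (\<rho> j / real n) / (1 - \<rho> j / real n) *
      measure_pmf.expectation (binomial_vector n)
        (\<lambda>k. xlogx_divergence (f k) (f (k(j := Suc (k j))))))
     \<longlonglongrightarrow> (\<Sum>j\<in>A. \<rho> j * measure_pmf.expectation \<mu> (\<lambda>k. xlogx_divergence (f k) (f (k(j := Suc (k j))))))"
    by (intro tendsto_sum tendsto_mult w expectation_binomial_vector_tendsto J)
  show "\<forall>\<^sub>F n in sequentially. entropy_pmf (binomial_vector n) f
      \<le> (\<Sum>j\<in>A. real n * (\<rho> j / real n) / (1 - \<rho> j / real n) *
        measure_pmf.expectation (binomial_vector n)
          (\<lambda>k. xlogx_divergence (f k) (f (k(j := Suc (k j))))))"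
    using eventually_rate_less
  proof eventually_elim
    case (elim n)
    then show ?case
      unfolding binomial_vector_def using rate_nonneg
      by (intro entropy_Pi_binomial_pmf_le finite_index pos)
         (auto simp: divide_less_eq split: if_splits dest: order.strict_trans1)
  qed
qed

text \<open>
  The Chen-Stein identity (the Mecke formula for a vector of counts): the weights satisfy
  \<open>(k j + 1) pmf (k + e j) = \<rho> j pmf k\<close>.
\<close>

lemma expectation_count_times:
  fixes g :: "('i \<Rightarrow> nat) \<Rightarrow> real"
  assumes j: "j \<in> A"
  shows "measure_pmf.expectation \<mu> (\<lambda>k. real (k j) * g k)
    = \<rho> j * measure_pmf.expectation \<mu> (\<lambda>k. g (k(j := Suc (k j))))"
proof -
  \<comment> \<open>Adding one point at index \<open>j\<close> is a bijection onto the vectors with a point there.\<close>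
  define T :: "('i \<Rightarrow> nat) \<Rightarrow> 'i \<Rightarrow> nat" where "T = (\<lambda>k. k(j := Suc (k j)))"
  define B where "B = {k :: 'i \<Rightarrow> nat. k j > 0}"
  have T: "bij_betw T UNIV B"
    by (rule bij_betw_byWitness[where f' = "\<lambda>k. k(j := k j - 1)"])
       (auto simp: T_def B_def fun_eq_iff)
  have pmf_T: "pmf \<mu> (T k) * real (Suc (k j)) = \<rho> j * pmf \<mu> k" for k
  proof -
    have outside: "(\<forall>i. i \<notin> A \<longrightarrow> T k i = 0) \<longleftrightarrow> (\<forall>i. i \<notin> A \<longrightarrow> k i = 0)"
      using j by (auto simp: T_def)
    have "(\<Prod>i\<in>A - {j}. \<rho> i ^ T k i / fact (T k i) * exp (- \<rho> i))
        = (\<Prod>i\<in>A - {j}. \<rho> i ^ k i / fact (k i) * exp (- \<rho> i))"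
      by (intro prod.cong) (auto simp: T_def)
    then have "(\<Prod>i\<in>A. \<rho> i ^ T k i / fact (T k i) * exp (- \<rho> i)) * real (Suc (k j))
        = \<rho> j * (\<Prod>i\<in>A. \<rho> i ^ k i / fact (k i) * exp (- \<rho> i))"
      using j finite_index by (simp add: prod.remove T_def del: of_nat_Suc)
    then show ?thesis
      using outside pmf_inside[of k] pmf_inside[of "T k"] pmf_outside[of _ k] pmf_outside[of _ "T k"]
      by (cases "\<forall>i. i \<notin> A \<longrightarrow> k i = 0") auto
  qed
  have "measure_pmf.expectation \<mu> (\<lambda>k. real (k j) * g k)
      = (\<integral>k. indicator B k *\<^sub>R (pmf \<mu> k * (real (k j) * g k)) \<partial>count_space UNIV)"
    unfolding expectation_pmf_eq_count_space
    by (intro Bochner_Integration.integral_cong) (auto simp: B_def indicator_def)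
  also have "\<dots> = (\<integral>k. pmf \<mu> k * (real (k j) * g k) \<partial>count_space B)"
    by (subst integral_restrict_space[symmetric]) (auto simp: restrict_count_space)
  also have "\<dots> = (\<integral>k. pmf \<mu> (T k) * (real (T k j) * g (T k)) \<partial>count_space UNIV)"
    by (rule integral_bij_count_space[OF T, symmetric])
  also have "\<dots> = (\<integral>k. \<rho> j * (pmf \<mu> k * g (T k)) \<partial>count_space UNIV)"
  proof (intro Bochner_Integration.integral_cong refl)
    fix k
    have "real (T k j) = real (Suc (k j))"
      by (simp add: T_def)
    then show "pmf \<mu> (T k) * (real (T k j) * g (T k)) = \<rho> j * (pmf \<mu> k * g (T k))"
      using pmf_T[of k] by (metis mult.assoc)
  qed
  also have "\<dots> = \<rho> j * measure_pmf.expectation \<mu> (\<lambda>k. g (T k))"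
    by (simp add: expectation_pmf_eq_count_space)
  finally show ?thesis
    by (simp add: T_def)
qed

end

section \<open>From entropy to moment generating functions\<close>

text \<open>
  The function \<open>y \<mapsto> 1 - exp y + y exp y\<close> is the divergence from \<open>1\<close> to \<open>exp y\<close>.
\<close>

lemma one_minus_exp_plus_le_square:
  fixes y t :: real
  assumes "y \<le> t" "0 \<le> t"
  shows "1 - exp y + y * exp y \<le> y\<^sup>2 / 2 * exp t"
proof (cases "y \<ge> 0")
  case True
  have "0\<^sup>2 / 2 * exp 0 - (1 - exp 0 + 0 * exp 0) \<le> y\<^sup>2 / 2 * exp y - (1 - exp y + y * exp y)"
  proof (rule DERIV_nonneg_imp_nondecreasing[OF True, where f = "\<lambda>y. y\<^sup>2 / 2 * exp y - (1 - exp y + y * exp y)"])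
    fix x :: real assume "0 \<le> x"
    show "\<exists>d. ((\<lambda>y. y\<^sup>2 / 2 * exp y - (1 - exp y + y * exp y)) has_real_derivative d) (at x) \<and> 0 \<le> d"
      by (intro exI[of _ "x\<^sup>2 / 2 * exp x"] conjI)
         (auto intro!: derivative_eq_intros simp: algebra_simps)
  qed
  also have "y\<^sup>2 / 2 * exp y \<le> y\<^sup>2 / 2 * exp t"
    using assms by (intro mult_left_mono) auto
  finally show ?thesis
    by simp
next
  case False
  have "y\<^sup>2 / 2 - (1 - exp y + y * exp y) \<ge> 0\<^sup>2 / 2 - (1 - exp 0 + 0 * exp 0)"
  proof (rule DERIV_nonpos_imp_nonincreasing[where f = "\<lambda>y. y\<^sup>2 / 2 - (1 - exp y + y * exp y)"])
    show "y \<le> 0"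
      using False by simp
    fix x :: real assume "x \<le> 0"
    then have "x * (1 - exp x) \<le> 0"
      by (intro mult_nonpos_nonneg) auto
    moreover have "((\<lambda>y. y\<^sup>2 / 2 - (1 - exp y + y * exp y)) has_real_derivative x * (1 - exp x)) (at x)"
      by (auto intro!: derivative_eq_intros simp: algebra_simps)
    ultimately show "\<exists>d. ((\<lambda>y. y\<^sup>2 / 2 - (1 - exp y + y * exp y)) has_real_derivative d) (at x) \<and> d \<le> 0"
      by blast
  qed
  moreover have "y\<^sup>2 / 2 * 1 \<le> y\<^sup>2 / 2 * exp t"
    using assms by (intro mult_left_mono) auto
  ultimately show ?thesis
    by simp
qed

text \<open>
  The pointwise inequality behind the concentration bound. Adding a point at \<open>x\<close> changes the supremum by
  some \<open>d \<le> 1\<close>, and \<open>d \<ge> s\<close> for the value \<open>s\<close> at \<open>x\<close> of the function that was optimal before. The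
  divergence \<open>p\<close> of the jump is at most \<open>t\<^sup>2 d\<^sup>2 exp t / 2\<close> and at most \<open>t d (exp (t d) - 1)\<close>; adding the
  first bound to \<open>t exp t\<close> times the second gives the claim with \<open>d\<^sup>2 / 2 - d\<close> in place of
  \<open>s\<^sup>2 / 2 - s\<close>. Passing to \<open>s\<close> is possible since \<open>x \<mapsto> x\<^sup>2 / 2 - x\<close> decreases up to 1. The three terms are
  of different use: \<open>s\<^sup>2\<close> integrates to at most the maximal variance, the Mecke formula turns
  \<open>d exp (t d)\<close> into a sum over the points of the process, and \<open>s\<close> compensates this sum.
\<close>

lemma jump_divergence_le:
  fixes s d t :: real
  assumes t: "0 \<le> t" and sd: "s \<le> d" "d \<le> 1"
  shows "(1 + t * exp t) * (1 - exp (t * d) + t * d * exp (t * d))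
    \<le> t\<^sup>2 * exp t * (s\<^sup>2 / 2 - s + d * exp (t * d))"
proof -
  define p where "p = 1 - exp (t * d) + t * d * exp (t * d)"
  have "t * d \<le> t * 1"
    using t sd by (intro mult_left_mono)
  then have 1: "p \<le> (t * d)\<^sup>2 / 2 * exp t"
    unfolding p_def using t by (intro one_minus_exp_plus_le_square) simp_all
  have "p \<le> t * d * (exp (t * d) - 1)"
    using exp_ge_add_one_self[of "t * d"] by (simp add: p_def algebra_simps)
  then have 2: "t * exp t * p \<le> t * exp t * (t * d * (exp (t * d) - 1))"
    using t by (intro mult_left_mono) auto
  have "(d - s) * (d + s) \<le> (d - s) * 2"
    using sd by (intro mult_left_mono) auto
  then have 3: "d\<^sup>2 / 2 - d \<le> s\<^sup>2 / 2 - s"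
    by (simp add: power2_eq_square algebra_simps)
  have "(1 + t * exp t) * p \<le> t\<^sup>2 * exp t * (d\<^sup>2 / 2 - d + d * exp (t * d))"
    using 1 2 by (simp add: power2_eq_square algebra_simps)
  also have "\<dots> \<le> t\<^sup>2 * exp t * (s\<^sup>2 / 2 - s + d * exp (t * d))"
    using 3 by (intro mult_left_mono) auto
  finally show ?thesis
    unfolding p_def .
qed

text \<open>
  Herbst's argument. For \<open>w t = ln (m t) + t v / 2\<close> the hypothesis reads
  \<open>t w' \<le> (1 + t exp t) w\<close>, that is, \<open>w\<close> divided by \<open>t exp (exp t - 1)\<close> does not increase. Its limit at 0 is
  \<open>m' 0 + v / 2\<close>.
\<close>

lemma ln_le_of_entropy_differential_inequality:
  fixes m m' :: "real \<Rightarrow> real"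
  assumes deriv: "\<And>t. 0 \<le> t \<Longrightarrow> (m has_real_derivative m' t) (at t)"
    and pos: "\<And>t. 0 \<le> t \<Longrightarrow> 0 < m t" and m0: "m 0 = 1"
    and ineq: "\<And>t. 0 < t \<Longrightarrow>
      (1 + t * exp t) * (t * m' t - m t * ln (m t)) \<le> t\<^sup>2 * exp t * (m' t + v / 2 * m t)"
    and t: "0 \<le> t"
  shows "ln (m t) \<le> t * m' 0 + t / 2 * (2 * m' 0 + v) * (exp (exp t - 1) - 1)"
proof (cases "t = 0")
  case True
  then show ?thesis
    by (simp add: m0)
next
  case False
  with t have t: "t > 0"
    by simp
  define w where "w = (\<lambda>t. ln (m t) + t * v / 2)"
  define w' where "w' = (\<lambda>t. m' t / m t + v / 2)"
  define r where "r = (\<lambda>t. w t * exp (1 - exp t) / t)"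
  have w: "(w has_real_derivative w' t) (at t)" if "0 \<le> t" for t
    unfolding w_def w'_def using that
    by (auto intro!: derivative_eq_intros deriv pos)
  have w_ineq: "t * w' t \<le> (1 + t * exp t) * w t" if "0 < t" for t
  proof -
    have m: "m t > 0"
      using that by (intro pos) simp
    have "(1 + t * exp t) * (t * w' t - w t) * m t = (1 + t * exp t) * (t * m' t - m t * ln (m t))"
      using m by (simp add: w_def w'_def field_simps)
    also have "\<dots> \<le> t\<^sup>2 * exp t * (m' t + v / 2 * m t)"
      using that by (rule ineq)
    also have "\<dots> = t\<^sup>2 * exp t * w' t * m t"
      using m by (simp add: w'_def field_simps)
    finally have "(1 + t * exp t) * (t * w' t - w t) \<le> t\<^sup>2 * exp t * w' t"
      using m by simp
    then show ?thesis
      by (simp add: power2_eq_square algebra_simps)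
  qed
  have r_mono: "r t \<le> r e" if "0 < e" "e \<le> t" for e
  proof (rule DERIV_nonpos_imp_nonincreasing[OF that(2)])
    fix x assume "e \<le> x"
    then have x: "0 < x"
      using that by simp
    have "(r has_real_derivative (exp (1 - exp x) / x\<^sup>2 * (x * w' x - (1 + x * exp x) * w x))) (at x)"
      unfolding r_def using x
      by (auto intro!: derivative_eq_intros w simp: field_simps power2_eq_square)
    moreover have "exp (1 - exp x) / x\<^sup>2 * (x * w' x - (1 + x * exp x) * w x) \<le> 0"
      using w_ineq[OF x] by (intro mult_nonneg_nonpos) auto
    ultimately show "\<exists>d. (r has_real_derivative d) (at x) \<and> d \<le> 0"
      by blast
  qed
  have "((\<lambda>t. w t / t) \<longlongrightarrow> w' 0) (at_right 0)"
    using w[of 0] unfolding has_field_derivative_iff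
    by (intro filterlim_mono[OF _ order_refl at_le[of "{0<..}" UNIV]]) (auto simp: w_def m0)
  then have "((\<lambda>t. w t / t * exp (1 - exp t)) \<longlongrightarrow> w' 0 * exp (1 - exp 0)) (at_right 0)"
    by (intro tendsto_mult tendsto_exp tendsto_diff tendsto_const tendsto_ident_at)
  then have "(r \<longlongrightarrow> w' 0) (at_right 0)"
    by (simp add: r_def)
  moreover have "\<forall>\<^sub>F e in at_right 0. r t \<le> r e"
    unfolding eventually_at_right_field using r_mono t by (intro exI[of _ t]) auto
  ultimately have "r t \<le> w' 0"
    by (intro tendsto_lowerbound) auto
  then have "w t * exp (1 - exp t) \<le> t * w' 0"
    using t by (simp add: r_def field_simps)
  then have "w t * exp (1 - exp t) * exp (exp t - 1) \<le> t * w' 0 * exp (exp t - 1)"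
    by (intro mult_right_mono) auto
  then have "w t \<le> t * w' 0 * exp (exp t - 1)"
    by (simp add: mult.assoc flip: exp_add)
  then show ?thesis
    by (simp add: w_def w'_def m0 field_simps)
qed

lemma abs_exp_minus_one_le:
  fixes x :: real
  shows "\<bar>exp x - 1\<bar> \<le> \<bar>x\<bar> * exp \<bar>x\<bar>"
proof (cases "x \<ge> 0")
  case True
  have "exp x * (1 - x) \<le> exp x * exp (- x)"
    using exp_ge_add_one_self[of "- x"] by (intro mult_left_mono) auto
  then show ?thesis
    using True by (simp add: algebra_simps flip: exp_add)
next
  case False
  have "- x * 1 \<le> - x * exp (- x)"
    using False by (intro mult_left_mono) auto
  moreover have "1 - exp x \<le> - x"
    using exp_ge_add_one_self[of x] by linarith
  ultimately have "1 - exp x \<le> - x * exp (- x)"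
    by linarith
  then show ?thesis
    using False by simp
qed

lemma mgf_has_real_derivative:
  fixes X :: "'a \<Rightarrow> real"
  assumes [measurable]: "X \<in> borel_measurable M"
    and int: "\<And>c. integrable M (\<lambda>x. exp (c * \<bar>X x\<bar>))"
  shows "((\<lambda>t. \<integral>x. exp (t * X x) \<partial>M) has_real_derivative (\<integral>x. X x * exp (t * X x) \<partial>M)) (at t)"
  unfolding DERIV_def tendsto_at_iff_sequentially
proof (intro allI impI)
  fix h :: "nat \<Rightarrow> real"
  assume h: "\<forall>i. h i \<in> UNIV - {0}" "h \<longlonglongrightarrow> 0"
  obtain B where B: "B > 0" "\<And>n. \<bar>h n\<bar> \<le> B"
    using convergent_imp_Bseq[of h] h(2) by (auto simp: Bseq_def convergent_def)
  have intt: "integrable M (\<lambda>x. exp (t * X x))" for t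
    by (rule Bochner_Integration.integrable_bound[OF int[of "\<bar>t\<bar>"]])
       (auto simp: abs_mult[symmetric] intro!: AE_I2)
  have lim: "(\<lambda>n. \<integral>x. (exp ((t + h n) * X x) - exp (t * X x)) / h n \<partial>M) \<longlonglongrightarrow> (\<integral>x. X x * exp (t * X x) \<partial>M)"
  proof (rule integral_dominated_convergence[where w = "\<lambda>x. exp ((1 + \<bar>t\<bar> + B) * \<bar>X x\<bar>)"])
    show "AE x in M. (\<lambda>n. (exp ((t + h n) * X x) - exp (t * X x)) / h n) \<longlonglongrightarrow> X x * exp (t * X x)"
    proof (intro AE_I2)
      fix x
      have "((\<lambda>t. exp (t * X x)) has_real_derivative X x * exp (t * X x)) (at t)"
        by (auto intro!: derivative_eq_intros)
      then show "(\<lambda>n. (exp ((t + h n) * X x) - exp (t * X x)) / h n) \<longlonglongrightarrow> X x * exp (t * X x)"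
        using h unfolding DERIV_def tendsto_at_iff_sequentially by (auto simp: comp_def)
    qed
    show "AE x in M. norm ((exp ((t + h n) * X x) - exp (t * X x)) / h n) \<le> exp ((1 + \<bar>t\<bar> + B) * \<bar>X x\<bar>)" for n
    proof (intro AE_I2)
      fix x
      have hn: "h n \<noteq> 0"
        using h by auto
      have "exp ((t + h n) * X x) - exp (t * X x) = exp (t * X x) * (exp (h n * X x) - 1)"
        by (simp add: algebra_simps flip: exp_add)
      then have "norm ((exp ((t + h n) * X x) - exp (t * X x)) / h n)
          = exp (t * X x) * \<bar>exp (h n * X x) - 1\<bar> / \<bar>h n\<bar>"
        by (simp add: abs_mult)
      also have "\<dots> \<le> exp (t * X x) * (\<bar>h n * X x\<bar> * exp \<bar>h n * X x\<bar>) / \<bar>h n\<bar>"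
        by (intro divide_right_mono mult_left_mono abs_exp_minus_one_le) auto
      also have "\<dots> = \<bar>X x\<bar> * (exp (t * X x) * exp \<bar>h n * X x\<bar>)"
        using hn by (simp add: abs_mult)
      also have "\<dots> \<le> exp \<bar>X x\<bar> * (exp (\<bar>t\<bar> * \<bar>X x\<bar>) * exp (B * \<bar>X x\<bar>))"
      proof (intro mult_mono)
        show "\<bar>X x\<bar> \<le> exp \<bar>X x\<bar>"
          using exp_ge_add_one_self[of "\<bar>X x\<bar>"] by linarith
        show "exp (t * X x) \<le> exp (\<bar>t\<bar> * \<bar>X x\<bar>)"
          by (simp add: abs_mult[symmetric])
        show "exp \<bar>h n * X x\<bar> \<le> exp (B * \<bar>X x\<bar>)"
          using B by (auto simp: abs_mult intro!: mult_right_mono)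
      qed auto
      also have "\<dots> = exp ((1 + \<bar>t\<bar> + B) * \<bar>X x\<bar>)"
        by (simp add: algebra_simps flip: exp_add)
      finally show "norm ((exp ((t + h n) * X x) - exp (t * X x)) / h n) \<le> exp ((1 + \<bar>t\<bar> + B) * \<bar>X x\<bar>)" .
    qed
  qed (use int in auto)
  have eq: "(\<integral>x. (exp ((t + h n) * X x) - exp (t * X x)) / h n \<partial>M)
      = ((\<integral>x. exp ((t + h n) * X x) \<partial>M) - (\<integral>x. exp (t * X x) \<partial>M)) / h n" for n
    using intt by simp
  from lim show "((\<lambda>h. ((\<integral>x. exp ((t + h) * X x) \<partial>M) - (\<integral>x. exp (t * X x) \<partial>M)) / h) \<circ> h)
      \<longlonglongrightarrow> (\<integral>x. X x * exp (t * X x) \<partial>M)"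
    by (simp only: comp_def eq)
qed

section \<open>Maxima of linear statistics of Poisson vectors\<close>

context poisson_vector
begin

lemma integrable_exp_dominated:
  fixes f :: "('i \<Rightarrow> nat) \<Rightarrow> real"
  assumes "\<And>k. \<bar>f k\<bar> \<le> b * exp (c * ((\<Sum>j\<in>A. real (k j)) + d))"
  shows "integrable (measure_pmf \<mu>) f"
proof (rule Bochner_Integration.integrable_bound)
  show "integrable (measure_pmf \<mu>) (\<lambda>k. b * exp (c * d) * exp (c * (\<Sum>j\<in>A. real (k j))))"
    by (intro integrable_mult_right exp_moments)
  show "AE k in \<mu>. norm (f k) \<le> norm (b * exp (c * d) * exp (c * (\<Sum>j\<in>A. real (k j))))"
  proof (intro AE_I2)
    fix k
    have "b * exp (c * d) * exp (c * (\<Sum>j\<in>A. real (k j))) = b * exp (c * ((\<Sum>j\<in>A. real (k j)) + d))"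
      by (simp add: algebra_simps flip: exp_add)
    then have "\<bar>f k\<bar> \<le> b * exp (c * d) * exp (c * (\<Sum>j\<in>A. real (k j)))"
      using assms[of k] by (simp only:)
    then show "norm (f k) \<le> norm (b * exp (c * d) * exp (c * (\<Sum>j\<in>A. real (k j))))"
      unfolding real_norm_def by (rule order_trans[OF _ abs_ge_self])
  qed
qed simp

text \<open>
  The bound on the moment generating function for finitely many compensated linear statistics. The
  entropy of \<open>F = exp (t Z)\<close> is bounded by the logarithmic Sobolev inequality, whose divergences are those
  of the lemma \<open>jump_divergence_le\<close>. The mean of \<open>d F\<close> after a jump is, by the Chen-Stein identity, a mean over the present
  points, where removing a point costs at most the value there of the function that is optimal now.
  Summed over all points and compensated, these values add up to \<open>Z\<close> itself, so that the right-hand side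
  closes up in terms of \<open>m t = E F\<close> and \<open>m' t = E (Z F)\<close>.
\<close>

theorem ln_mgf_max_le:
  fixes a :: "'c \<Rightarrow> 'i \<Rightarrow> real"
  assumes C: "finite C" "C \<noteq> {}"
    and a: "\<And>c j. c \<in> C \<Longrightarrow> j \<in> A \<Longrightarrow> \<bar>a c j\<bar> \<le> 1"
    and v: "\<And>c. c \<in> C \<Longrightarrow> (\<Sum>j\<in>A. \<rho> j * (a c j)\<^sup>2) \<le> v"
    and t: "0 \<le> t"
  defines "Z \<equiv> (\<lambda>k. MAX c\<in>C. \<Sum>j\<in>A. a c j * (real (k j) - \<rho> j))"
  shows "ln (measure_pmf.expectation \<mu> (\<lambda>k. exp (t * Z k)))
    \<le> t * measure_pmf.expectation \<mu> Z
      + t / 2 * (2 * measure_pmf.expectation \<mu> Z + v) * (exp (exp t - 1) - 1)"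
proof -
  define I where "I = (\<lambda>c k. \<Sum>j\<in>A. a c j * (real (k j) - \<rho> j))"
  \<comment> \<open>\<open>T j\<close> adds a point at index \<open>j\<close>; \<open>y\<close> is an envelope that dominates \<open>\<bar>Z\<bar>\<close>.\<close>
  define T :: "'i \<Rightarrow> ('i \<Rightarrow> nat) \<Rightarrow> 'i \<Rightarrow> nat" where "T = (\<lambda>j k. k(j := Suc (k j)))"
  define y where "y = (\<lambda>k. (\<Sum>j\<in>A. real (k j)) + (\<Sum>j\<in>A. \<rho> j))"
  have Z: "Z k = Max ((\<lambda>c. I c k) ` C)" for k
    by (simp add: Z_def I_def)
  have y0: "0 \<le> y k" for k
    unfolding y_def by (intro add_nonneg_nonneg sum_nonneg rate_nonneg) auto
  have I_T: "I c (T j k) = I c k + a c j" if "j \<in> A" for c j k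
  proof -
    have "I c (T j k) - I c k = (\<Sum>i\<in>A. if i = j then a c i else 0)"
      unfolding I_def sum_subtractf[symmetric]
      by (intro sum.cong) (auto simp: T_def algebra_simps)
    then show ?thesis
      using that finite_index by simp
  qed
  have y_T: "y (T j k) = y k + 1" if "j \<in> A" for j k
  proof -
    have "y (T j k) - y k = (\<Sum>i\<in>A. real (T j k i) - real (k i))"
      by (simp add: y_def sum_subtractf)
    also have "\<dots> = (\<Sum>i\<in>A. if i = j then 1 else 0)"
      by (intro sum.cong) (auto simp: T_def)
    finally show ?thesis
      using that finite_index by simp
  qed
  have I_le_Z: "I c k \<le> Z k" if "c \<in> C" for c k
    unfolding Z using C that by (intro Max_ge) auto
  have "\<exists>c. c \<in> C \<and> I c k = Z k" for k
  proof -
    have "Z k \<in> (\<lambda>c. I c k) ` C"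
      unfolding Z using C by (intro Max_in) auto
    then show ?thesis
      by force
  qed
  \<comment> \<open>An index that attains the maximum at \<open>k\<close>; later \<open>s j k\<close> is its coefficient at \<open>j\<close>.\<close>
  then obtain am where am: "\<And>k. am k \<in> C" "\<And>k. I (am k) k = Z k"
    by metis
  have D_ge: "a (am k) j \<le> Z (T j k) - Z k" if "j \<in> A" for j k
    using I_le_Z[OF am(1)[of k], of "T j k"] I_T[OF that, of "am k" k] am(2)[of k] by simp
  have D_le: "Z (T j k) - Z k \<le> a (am (T j k)) j" if "j \<in> A" for j k
    using I_le_Z[OF am(1)[of "T j k"], of k] I_T[OF that, of "am (T j k)" k] am(2)[of "T j k"] by simp
  have D_le1: "Z (T j k) - Z k \<le> 1" and D_abs: "\<bar>Z (T j k) - Z k\<bar> \<le> 1" if "j \<in> A" for j k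
    using D_ge[OF that, of k] D_le[OF that, of k] a[OF am(1) that, of k] a[OF am(1) that, of "T j k"]
    by linarith+
  have Z_abs: "\<bar>Z k\<bar> \<le> y k" for k
  proof -
    have "\<bar>I (am k) k\<bar> \<le> (\<Sum>j\<in>A. \<bar>a (am k) j * (real (k j) - \<rho> j)\<bar>)"
      unfolding I_def by (rule sum_abs)
    also have "\<dots> \<le> (\<Sum>j\<in>A. 1 * (real (k j) + \<rho> j))"
      unfolding abs_mult using a[OF am(1)] rate_nonneg
      by (intro sum_mono mult_mono) (auto intro!: abs_leI simp: rate_nonneg add_increasing)
    finally show ?thesis
      by (simp add: am y_def sum.distrib)
  qed
  have le_exp: "x \<le> exp x" for x :: real
    using exp_ge_add_one_self[of x] by linarith
  have int: "integrable (measure_pmf \<mu>) f" if "\<And>k. \<bar>f k\<bar> \<le> b * exp (c * y k)" for f b c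
    using that unfolding y_def by (rule integrable_exp_dominated)
  have int_exp_abs: "integrable (measure_pmf \<mu>) (\<lambda>k. exp (c * \<bar>Z k\<bar>))" for c
  proof (rule int[of _ 1 "\<bar>c\<bar>"])
    fix k
    have "c * \<bar>Z k\<bar> \<le> \<bar>c\<bar> * y k"
      using Z_abs[of k] by (intro mult_mono) auto
    then show "\<bar>exp (c * \<bar>Z k\<bar>)\<bar> \<le> 1 * exp (\<bar>c\<bar> * y k)"
      by simp
  qed
  define m where "m = (\<lambda>t. measure_pmf.expectation \<mu> (\<lambda>k. exp (t * Z k)))"
  define m' where "m' = (\<lambda>t. measure_pmf.expectation \<mu> (\<lambda>k. Z k * exp (t * Z k)))"
  have ineq: "(1 + t * exp t) * (t * m' t - m t * ln (m t)) \<le> t\<^sup>2 * exp t * (m' t + v / 2 * m t)"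
    if t: "t > 0" for t
  proof -
    define F where "F = (\<lambda>k. exp (t * Z k))"
    have Fpos: "F k > 0" for k
      by (simp add: F_def)
    have F_le: "F k \<le> exp (t * y k)" for k
      using Z_abs[of k] t by (auto simp: F_def intro!: mult_left_mono)
    have y_le: "y k \<le> exp (y k)" for k
      by (rule le_exp)
    have yF_le: "y k * F k \<le> 1 * exp ((1 + t) * y k)" for k
      using mult_mono[OF y_le[of k] F_le[of k]] y0[of k] Fpos[of k]
      by (simp add: algebra_simps exp_add)
    have intF: "integrable (measure_pmf \<mu>) F"
      using Fpos F_le by (intro int[of _ 1 t]) (simp add: abs_of_pos)
    have int_yF: "integrable (measure_pmf \<mu>) (\<lambda>k. y k * F k)"
      using Fpos y0 yF_le by (intro int[of _ 1 "1 + t"]) (simp add: abs_mult less_imp_le)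
    have int_le_yF: "integrable (measure_pmf \<mu>) f" if "\<And>k. \<bar>f k\<bar> \<le> y k * F k" for f
      using that y0 Fpos by (intro Bochner_Integration.integrable_bound[OF int_yF])
        (auto simp: abs_mult less_imp_le)
    have int_le_F: "integrable (measure_pmf \<mu>) f" if "\<And>k. \<bar>f k\<bar> \<le> F k" for f
      using that Fpos by (intro Bochner_Integration.integrable_bound[OF intF]) (auto simp: less_imp_le)
    have intZF: "integrable (measure_pmf \<mu>) (\<lambda>k. Z k * F k)"
      using Z_abs Fpos by (intro int_le_yF) (simp add: abs_mult less_imp_le)
    have F_T: "F (T j k) = F k * exp (t * (Z (T j k) - Z k))" for j k
      by (simp add: F_def algebra_simps flip: exp_add)
    have F_T_le: "F (T j k) \<le> exp t * F k" if "j \<in> A" for j k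
      using D_le1[OF that, of k] t Fpos[of k]
      by (simp add: F_T mult.commute mult_left_le)
    have intFT: "integrable (measure_pmf \<mu>) (\<lambda>k. F (T j k))" if "j \<in> A" for j
      using F_T_le[OF that] Fpos
      by (intro Bochner_Integration.integrable_bound[OF integrable_mult_right[OF intF, of "exp t"]])
         (auto simp: less_imp_le)
    define D where "D = (\<lambda>j k. Z (T j k) - Z k)"
    have F_D: "F (T j k) = F k * exp (t * D j k)" for j k
      unfolding D_def by (rule F_T)
    have intDFT: "integrable (measure_pmf \<mu>) (\<lambda>k. D j k * F (T j k))" if "j \<in> A" for j
      using D_abs[OF that] Fpos
      by (intro Bochner_Integration.integrable_bound[OF intFT[OF that]])
         (auto simp: D_def abs_mult less_imp_le mult_left_le_one_le)
    define J where "J = (\<lambda>j k. xlogx_divergence (F k) (F (T j k)))"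
    have J1: "J j k = t * (D j k * F (T j k)) - F (T j k) + F k" for j k
      unfolding J_def xlogx_divergence_def by (simp add: F_def D_def algebra_simps)
    have J2: "J j k = F k * (1 - exp (t * D j k) + t * D j k * exp (t * D j k))" for j k
      unfolding J1 F_T D_def by (simp add: algebra_simps)
    have intJ: "integrable (measure_pmf \<mu>) (J j)" if "j \<in> A" for j
      unfolding J1[abs_def] using that
      by (intro Bochner_Integration.integrable_add Bochner_Integration.integrable_diff
          integrable_mult_right intDFT intFT intF)
    have "entropy_pmf \<mu> F \<le> (\<Sum>j\<in>A. \<rho> j * measure_pmf.expectation \<mu> (J j))"
      unfolding J_def T_def
    proof (rule entropy_poisson_le)
      show "integrable (measure_pmf \<mu>) (\<lambda>k. F k * ln (F k))"
        using integrable_mult_right[OF intZF, of t] by (simp add: F_def algebra_simps)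
    qed (use Fpos intF intJ in \<open>auto simp: J_def T_def\<close>)
    moreover have "entropy_pmf \<mu> F = t * m' t - m t * ln (m t)"
      unfolding entropy_pmf_def m_def m'_def F_def
      by (simp add: mult_ac flip: integral_mult_right_zero)
    ultimately have ent: "t * m' t - m t * ln (m t) \<le> (\<Sum>j\<in>A. \<rho> j * measure_pmf.expectation \<mu> (J j))"
      by simp
    define s where "s = (\<lambda>j k. a (am k) j)"
    have s_abs: "\<bar>s j k\<bar> \<le> 1" if "j \<in> A" for j k
      using a[OF am(1) that] by (simp add: s_def)
    have ints: "integrable (measure_pmf \<mu>) (\<lambda>k. F k * s j k)" if "j \<in> A" for j
      using s_abs[OF that] Fpos by (intro int_le_F) (simp add: abs_mult less_imp_le mult_left_le)
    have ints2: "integrable (measure_pmf \<mu>) (\<lambda>k. F k * (s j k)\<^sup>2)" if "j \<in> A" for j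
      using s_abs[OF that] Fpos
      by (intro int_le_F) (simp add: abs_mult less_imp_le mult_left_le abs_square_le_1)
    have k_le_y: "real (k j) \<le> y k" if "j \<in> A" for j k
    proof -
      have "real (k j) \<le> (\<Sum>j\<in>A. real (k j))"
        using that finite_index by (intro member_le_sum) auto
      then show ?thesis
        unfolding y_def using sum_nonneg[of A \<rho>] rate_nonneg by simp
    qed
    have intks: "integrable (measure_pmf \<mu>) (\<lambda>k. real (k j) * F k * s j k)" if "j \<in> A" for j
    proof (rule int_le_yF)
      fix k
      have "\<bar>real (k j) * F k * s j k\<bar> \<le> y k * F k * 1"
        unfolding abs_mult using k_le_y[OF that, of k] s_abs[OF that, of k] Fpos[of k] y0[of k]
        by (intro mult_mono) (auto simp: less_imp_le)
      then show "\<bar>real (k j) * F k * s j k\<bar> \<le> y k * F k"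
        by simp
    qed
    \<comment> \<open>The summand for removing a point; the truncated subtraction only matters where it is multiplied by \<open>k j = 0\<close>.\<close>
    define g where "g = (\<lambda>j k. F k * (Z k - Z (k(j := k j - 1))))"
    have g_T: "g j (T j k) = D j k * F (T j k)" for j k
      by (simp add: g_def D_def T_def)
    have pred: "k = T j (k(j := k j - 1))" if "k j > 0" for j k
      using that by (simp add: T_def)
    have kg_le: "real (k j) * g j k \<le> real (k j) * F k * s j k" if "j \<in> A" for j k
    proof (cases "k j = 0")
      case False
      then have "g j k \<le> F k * s j k"
        using D_le[OF that, of "k(j := k j - 1)"] pred[of k j] Fpos[of k]
        unfolding g_def s_def by (intro mult_left_mono) auto
      then show ?thesis
        by (simp add: mult.assoc mult_left_mono)
    qed simp
    have intkg: "integrable (measure_pmf \<mu>) (\<lambda>k. real (k j) * g j k)" if "j \<in> A" for j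
    proof (rule int_le_yF)
      fix k
      show "\<bar>real (k j) * g j k\<bar> \<le> y k * F k"
      proof (cases "k j = 0")
        case True
        then show ?thesis
          using y0 Fpos by (simp add: less_imp_le)
      next
        case False
        then have "\<bar>Z k - Z (k(j := k j - 1))\<bar> \<le> 1"
          using D_abs[OF that, of "k(j := k j - 1)"] pred[of k j] by simp
        then have "\<bar>real (k j) * g j k\<bar> \<le> y k * (F k * 1)"
          unfolding abs_mult g_def using k_le_y[OF that, of k] Fpos[of k] y0[of k]
          by (intro mult_mono) (auto simp: less_imp_le)
        then show ?thesis
          by simp
      qed
    qed
    have jump: "\<rho> j * measure_pmf.expectation \<mu> (\<lambda>k. D j k * F (T j k))
        \<le> measure_pmf.expectation \<mu> (\<lambda>k. real (k j) * F k * s j k)" if "j \<in> A" for j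
    proof -
      have "\<rho> j * measure_pmf.expectation \<mu> (\<lambda>k. D j k * F (T j k))
          = measure_pmf.expectation \<mu> (\<lambda>k. real (k j) * g j k)"
        using expectation_count_times[OF that, of "g j"] by (simp add: g_T[unfolded T_def] T_def)
      also have "\<dots> \<le> measure_pmf.expectation \<mu> (\<lambda>k. real (k j) * F k * s j k)"
        using that by (intro integral_mono intkg intks kg_le)
      finally show ?thesis .
    qed
    define e where "e = t\<^sup>2 * exp t"
    have e: "0 \<le> e"
      by (simp add: e_def)
    have per_index: "(1 + t * exp t) * (\<rho> j * measure_pmf.expectation \<mu> (J j)) \<le>
        e * (\<rho> j * measure_pmf.expectation \<mu> (\<lambda>k. F k * (s j k)\<^sup>2) / 2
          - \<rho> j * measure_pmf.expectation \<mu> (\<lambda>k. F k * s j k)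
          + measure_pmf.expectation \<mu> (\<lambda>k. real (k j) * F k * s j k))" if "j \<in> A" for j
    proof -
      have "(1 + t * exp t) * measure_pmf.expectation \<mu> (J j)
          = measure_pmf.expectation \<mu> (\<lambda>k. (1 + t * exp t) * J j k)"
        by simp
      also have "\<dots> \<le> measure_pmf.expectation \<mu>
          (\<lambda>k. e * (F k * (s j k)\<^sup>2 / 2 - F k * s j k + D j k * F (T j k)))"
      proof (intro integral_mono integrable_mult_right Bochner_Integration.integrable_add
          Bochner_Integration.integrable_diff integrable_divide_zero intJ ints ints2 intDFT that)
        fix k
        have "F k * ((1 + t * exp t) * (1 - exp (t * D j k) + t * D j k * exp (t * D j k)))
            \<le> F k * (e * ((s j k)\<^sup>2 / 2 - s j k + D j k * exp (t * D j k)))"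
          unfolding e_def using D_ge[OF that, of k] D_le1[OF that, of k] t Fpos[of k]
          by (intro mult_left_mono jump_divergence_le) (auto simp: D_def s_def)
        then show "(1 + t * exp t) * J j k
            \<le> e * (F k * (s j k)\<^sup>2 / 2 - F k * s j k + D j k * F (T j k))"
          unfolding J2 F_D[of j k] by (simp only: algebra_simps)
      qed
      also have "\<dots> = e * (measure_pmf.expectation \<mu> (\<lambda>k. F k * (s j k)\<^sup>2) / 2
          - measure_pmf.expectation \<mu> (\<lambda>k. F k * s j k)
          + measure_pmf.expectation \<mu> (\<lambda>k. D j k * F (T j k)))"
        using ints[OF that] ints2[OF that] intDFT[OF that] by simp
      finally have "\<rho> j * ((1 + t * exp t) * measure_pmf.expectation \<mu> (J j)) \<le> \<rho> j *
          (e * (measure_pmf.expectation \<mu> (\<lambda>k. F k * (s j k)\<^sup>2) / 2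
          - measure_pmf.expectation \<mu> (\<lambda>k. F k * s j k)
          + measure_pmf.expectation \<mu> (\<lambda>k. D j k * F (T j k))))"
        using rate_nonneg[OF that] by (intro mult_left_mono)
      moreover have "e * (\<rho> j * measure_pmf.expectation \<mu> (\<lambda>k. D j k * F (T j k)))
          \<le> e * measure_pmf.expectation \<mu> (\<lambda>k. real (k j) * F k * s j k)"
        using jump[OF that] e by (intro mult_left_mono)
      ultimately show ?thesis
        by (simp add: algebra_simps)
    qed
    have "(1 + t * exp t) * (t * m' t - m t * ln (m t))
        \<le> (1 + t * exp t) * (\<Sum>j\<in>A. \<rho> j * measure_pmf.expectation \<mu> (J j))"
      using ent t by (intro mult_left_mono) auto
    also have "\<dots> \<le> (\<Sum>j\<in>A. e * (\<rho> j * measure_pmf.expectation \<mu> (\<lambda>k. F k * (s j k)\<^sup>2) / 2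
          - \<rho> j * measure_pmf.expectation \<mu> (\<lambda>k. F k * s j k)
          + measure_pmf.expectation \<mu> (\<lambda>k. real (k j) * F k * s j k)))"
      unfolding sum_distrib_left by (intro sum_mono per_index)
    also have "\<dots> = e * measure_pmf.expectation \<mu> (\<lambda>k. \<Sum>j\<in>A. \<rho> j * (F k * (s j k)\<^sup>2) / 2
          - \<rho> j * (F k * s j k) + real (k j) * F k * s j k)"
      using ints ints2 intks by (simp add: sum_distrib_left Bochner_Integration.integral_sum)
    also have "\<dots> \<le> e * measure_pmf.expectation \<mu> (\<lambda>k. v / 2 * F k + Z k * F k)"
    proof (intro mult_left_mono integral_mono e)
      fix k
      have "(\<Sum>j\<in>A. \<rho> j * (F k * (s j k)\<^sup>2) / 2 - \<rho> j * (F k * s j k) + real (k j) * F k * s j k)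
          = F k / 2 * (\<Sum>j\<in>A. \<rho> j * (s j k)\<^sup>2) + F k * I (am k) k"
        by (simp add: I_def s_def sum.distrib sum_subtractf sum_distrib_left algebra_simps sum_divide_distrib)
      also have "\<dots> \<le> F k / 2 * v + F k * Z k"
        unfolding am s_def using v[OF am(1), of k] Fpos[of k]
        by (intro add_right_mono mult_left_mono) auto
      finally show "(\<Sum>j\<in>A. \<rho> j * (F k * (s j k)\<^sup>2) / 2 - \<rho> j * (F k * s j k) + real (k j) * F k * s j k)
          \<le> v / 2 * F k + Z k * F k"
        by (simp add: mult.commute)
    qed (use ints ints2 intks intF intZF in auto)
    also have "\<dots> = e * (m' t + v / 2 * m t)"
      using intF intZF by (simp add: m_def m'_def F_def add.commute)
    finally show ?thesis
      unfolding e_def .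
  qed
  have "ln (m t) \<le> t * m' 0 + t / 2 * (2 * m' 0 + v) * (exp (exp t - 1) - 1)"
  proof (rule ln_le_of_entropy_differential_inequality[OF _ _ _ ineq t])
    show "(m has_real_derivative m' t) (at t)" for t
      unfolding m_def m'_def by (rule mgf_has_real_derivative) (use int_exp_abs in auto)
    show "0 < m t" for t
      unfolding m_def
    proof (intro measure_pmf.expectation_greater AE_I2)
      show "integrable (measure_pmf \<mu>) (\<lambda>k. exp (t * Z k))"
        by (rule Bochner_Integration.integrable_bound[OF int_exp_abs[of "\<bar>t\<bar>"]])
           (auto simp: abs_mult[symmetric])
    qed auto
    show "m 0 = 1"
      by (simp add: m_def)
  qed
  then show ?thesis
    by (simp add: m_def m'_def)
qed

end

context poisson_vector
begin

lemma integrable_polynomial_counts: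
  fixes f :: "('i \<Rightarrow> nat) \<Rightarrow> real"
  assumes "\<And>k. \<bar>f k\<bar> \<le> b * (1 + (\<Sum>j\<in>A. real (k j))) ^ n"
  shows "integrable (measure_pmf \<mu>) f"
proof (rule integrable_exp_dominated)
  fix k
  define y where "y = (\<Sum>j\<in>A. real (k j))"
  have y: "0 \<le> y"
    unfolding y_def by (intro sum_nonneg) auto
  have "0 \<le> b * (1 + y) ^ n"
    using assms[of k] by (fold y_def) linarith
  moreover have "0 < (1 + y) ^ n"
    using y by (intro zero_less_power) simp
  ultimately have b: "0 \<le> b"
    by (metis mult_neg_pos not_le)
  have "(1 + y) ^ n \<le> exp y ^ n"
    using y by (intro power_mono) (simp_all add: exp_ge_add_one_self add.commute)
  also have "\<dots> = exp (real n * (y + 0))"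
    by (simp add: exp_of_nat_mult)
  finally have "b * (1 + y) ^ n \<le> b * exp (real n * (y + 0))"
    using b by (intro mult_left_mono)
  then show "\<bar>f k\<bar> \<le> b * exp (real n * ((\<Sum>j\<in>A. real (k j)) + 0))"
    using assms[of k] by (simp add: y_def)
qed

lemma linear_statistic_moments:
  fixes a :: "'i \<Rightarrow> real"
  assumes a: "\<And>j. j \<in> A \<Longrightarrow> \<bar>a j\<bar> \<le> 1"
  defines "I \<equiv> (\<lambda>k. \<Sum>j\<in>A. a j * (real (k j) - \<rho> j))"
  shows "measure_pmf.expectation \<mu> I = 0"
    and "measure_pmf.expectation \<mu> (\<lambda>k. (I k)\<^sup>2) = (\<Sum>j\<in>A. \<rho> j * (a j)\<^sup>2)"
proof -
  define y where "y = (\<lambda>k :: 'i \<Rightarrow> nat. \<Sum>j\<in>A. real (k j))"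
  define b where "b = 1 + (\<Sum>j\<in>A. \<rho> j)"
  have y0: "0 \<le> y k" for k
    unfolding y_def by (intro sum_nonneg) auto
  have b1: "1 \<le> b"
    unfolding b_def using sum_nonneg[of A \<rho>] rate_nonneg by simp
  have k_le: "real (k j) \<le> 1 + y k" if "j \<in> A" for j k
    using that finite_index member_le_sum[of j A "\<lambda>j. real (k j)"] by (simp add: y_def)
  have I_le: "\<bar>I k\<bar> \<le> b * (1 + y k)" for k
  proof -
    have "\<bar>I k\<bar> \<le> (\<Sum>j\<in>A. \<bar>a j * (real (k j) - \<rho> j)\<bar>)"
      unfolding I_def by (rule sum_abs)
    also have "\<dots> \<le> (\<Sum>j\<in>A. 1 * (real (k j) + \<rho> j))"
      unfolding abs_mult using a rate_nonneg
      by (intro sum_mono mult_mono) (auto intro!: abs_leI simp: rate_nonneg add_increasing)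
    also have "\<dots> = y k + (b - 1)"
      by (simp add: y_def b_def sum.distrib)
    also have "\<dots> \<le> b * (1 + y k)"
      using y0[of k] b1 mult_right_mono[of 1 b "y k"] by (simp add: algebra_simps)
    finally show ?thesis .
  qed
  have intI: "integrable (measure_pmf \<mu>) I"
    using I_le by (intro integrable_polynomial_counts[of _ b 1]) (simp add: y_def)
  have intk: "integrable (measure_pmf \<mu>) (\<lambda>k. real (k j))" if "j \<in> A" for j
    using k_le[OF that] by (intro integrable_polynomial_counts[of _ 1 1]) (simp add: y_def)
  have intkI: "integrable (measure_pmf \<mu>) (\<lambda>k. real (k j) * I k)" if "j \<in> A" for j
  proof (rule integrable_polynomial_counts[of _ b 2])
    fix k
    have "\<bar>real (k j) * I k\<bar> \<le> (1 + y k) * (b * (1 + y k))"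
      unfolding abs_mult using k_le[OF that, of k] I_le[of k] y0[of k] by (intro mult_mono) auto
    then show "\<bar>real (k j) * I k\<bar> \<le> b * (1 + (\<Sum>j\<in>A. real (k j)))\<^sup>2"
      by (simp add: y_def power2_eq_square algebra_simps)
  qed
  have Ek: "measure_pmf.expectation \<mu> (\<lambda>k. real (k j)) = \<rho> j" if "j \<in> A" for j
    using expectation_count_times[OF that, of "\<lambda>_. 1"] by simp
  have "measure_pmf.expectation \<mu> I = (\<Sum>j\<in>A. a j * (measure_pmf.expectation \<mu> (\<lambda>k. real (k j)) - \<rho> j))"
    unfolding I_def using intk by (simp add: Bochner_Integration.integral_sum)
  then show EI: "measure_pmf.expectation \<mu> I = 0"
    by (simp add: Ek)
  have EkI: "measure_pmf.expectation \<mu> (\<lambda>k. real (k j) * I k) = \<rho> j * a j" if "j \<in> A" for j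
  proof -
    have "I (k(j := Suc (k j))) = I k + a j" for k
    proof -
      have "I (k(j := Suc (k j))) - I k = (\<Sum>i\<in>A. if i = j then a i else 0)"
        unfolding I_def sum_subtractf[symmetric]
        by (intro sum.cong) (auto simp: algebra_simps)
      then show ?thesis
        using that finite_index by simp
    qed
    then show ?thesis
      using expectation_count_times[OF that, of I] intI EI by simp
  qed
  have "measure_pmf.expectation \<mu> (\<lambda>k. (I k)\<^sup>2)
      = measure_pmf.expectation \<mu> (\<lambda>k. \<Sum>j\<in>A. a j * (real (k j) * I k) - a j * \<rho> j * I k)"
  proof (intro Bochner_Integration.integral_cong refl)
    fix k
    have "(I k)\<^sup>2 = I k * (\<Sum>j\<in>A. a j * (real (k j) - \<rho> j))"
      by (simp add: power2_eq_square I_def)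
    also have "\<dots> = (\<Sum>j\<in>A. a j * (real (k j) * I k) - a j * \<rho> j * I k)"
      unfolding sum_distrib_left by (intro sum.cong) (auto simp: algebra_simps)
    finally show "(I k)\<^sup>2 = (\<Sum>j\<in>A. a j * (real (k j) * I k) - a j * \<rho> j * I k)" .
  qed
  also have "\<dots> = (\<Sum>j\<in>A. a j * (\<rho> j * a j))"
    using intkI intI EI EkI by (simp add: Bochner_Integration.integral_sum)
  finally show "measure_pmf.expectation \<mu> (\<lambda>k. (I k)\<^sup>2) = (\<Sum>j\<in>A. \<rho> j * (a j)\<^sup>2)"
    by (simp add: power2_eq_square mult_ac)
qed

end

section \<open>Counts of a Poisson process in a finite partition\<close>

lemma integral_step_function:
  fixes a :: "nat \<Rightarrow> real"
  assumes "finite_measure \<nu>" "sets \<nu> = sets borel"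
    and T: "T \<in> borel \<rightarrow>\<^sub>M count_space UNIV" "\<And>x. T x < K"
  shows "(\<integral>x. a (T x) \<partial>\<nu>) = (\<Sum>j<K. a j * measure \<nu> (T -` {j}))"
proof -
  interpret finite_measure \<nu> by fact
  have sets: "T -` {j} \<in> sets \<nu>" for j
    using measurable_sets[OF T(1), of "{j}"] assms(2) by simp
  have "(\<integral>x. a (T x) \<partial>\<nu>) = (\<integral>x. (\<Sum>j<K. a j * indicator (T -` {j}) x) \<partial>\<nu>)"
  proof (intro Bochner_Integration.integral_cong refl)
    fix x
    have "(\<Sum>j<K. a j * indicator (T -` {j}) x) = (\<Sum>j<K. if j = T x then a j else 0)"
      by (intro sum.cong) (auto simp: indicator_def)
    then show "a (T x) = (\<Sum>j<K. a j * indicator (T -` {j}) x)"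
      using T(2)[of x] by simp
  qed
  also have "\<dots> = (\<Sum>j<K. a j * measure \<nu> (T -` {j}))"
    using sets sets.Int_space_eq2[of "T -` {_}" \<nu>]
    by (subst Bochner_Integration.integral_sum) (auto simp: less_top[symmetric])
  finally show ?thesis .
qed

text \<open>
  Finitely many functions with finite ranges are constant on the cells of a common finite measurable
  partition; \<open>T\<close> numbers the cells.
\<close>

lemma finite_range_functions_factor_through_nat:
  fixes f :: "'c \<Rightarrow> 'x::topological_space \<Rightarrow> real"
  assumes C: "finite C"
    and meas: "\<And>c. c \<in> C \<Longrightarrow> f c \<in> borel_measurable borel"
    and range: "\<And>c. c \<in> C \<Longrightarrow> finite (range (f c))"
    and bound: "\<And>c x. c \<in> C \<Longrightarrow> \<bar>f c x\<bar> \<le> b"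
  obtains T :: "'x \<Rightarrow> nat" and K and a :: "'c \<Rightarrow> nat \<Rightarrow> real" where
    "T \<in> borel \<rightarrow>\<^sub>M count_space UNIV" "\<And>x. T x < K"
    "\<And>c x. c \<in> C \<Longrightarrow> f c x = a c (T x)"
    "\<And>c j. c \<in> C \<Longrightarrow> j < K \<Longrightarrow> \<bar>a c j\<bar> \<le> b"
proof -
  define h where "h = (\<lambda>x. restrict (\<lambda>c. f c x) C)"
  define S where "S = range h"
  have "S \<subseteq> (\<Pi>\<^sub>E c\<in>C. range (f c))"
    by (auto simp: S_def h_def)
  moreover have "finite (\<Pi>\<^sub>E c\<in>C. range (f c))"
    by (intro finite_PiE C range)
  ultimately have "finite S"
    by (rule finite_subset)
  then obtain e where e: "bij_betw e S {0..<card S}"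
    using ex_bij_betw_finite_nat by blast
  define T where "T = (\<lambda>x. e (h x))"
  define a where "a = (\<lambda>c j. inv_into S e j c)"
  have hS: "h x \<in> S" for x
    by (simp add: S_def)
  have inv_e: "inv_into S e (e g) = g" if "g \<in> S" for g
    using e that by (simp add: bij_betw_def)
  have T_less: "T x < card S" for x
    using bij_betwE[OF e] hS[of x] by (simp add: T_def)
  show thesis
  proof (rule that[of T "card S" a])
    show "T \<in> borel \<rightarrow>\<^sub>M count_space UNIV"
    proof (subst measurable_count_space_eq2_countable, intro conjI ballI)
      fix j :: nat
      show "T -` {j} \<inter> space borel \<in> sets borel"
      proof (cases "j < card S")
        case True
        then obtain g where g: "g \<in> S" "e g = j"
          using e unfolding bij_betw_def by (metis atLeastLessThan_iff imageE le0)
        have ext: "g \<in> extensional C" "h x \<in> extensional C" for x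
          using g by (auto simp: S_def h_def)
        have "T x = j \<longleftrightarrow> h x = g" for x
          unfolding T_def using g inv_e hS by metis
        moreover have "h x = g \<longleftrightarrow> (\<forall>c\<in>C. f c x = g c)" for x
          using extensionalityI[OF ext(2)[of x] ext(1)] by (auto simp: h_def)
        ultimately have "T -` {j} \<inter> space borel = {x \<in> space borel. \<forall>c\<in>C. f c x = g c}"
          by auto
        also have "\<dots> \<in> sets borel"
        proof (intro sets.sets_Collect_finite_All[OF _ C])
          fix c assume "c \<in> C"
          then have [measurable]: "f c \<in> borel_measurable borel"
            by (rule meas)
          show "{x \<in> space borel. f c x = g c} \<in> sets borel"
            by measurable
        qed
        finally show ?thesis .
      next
        case False
        then have "T -` {j} = {}"
          using T_less by auto
        then show ?thesis
          by simp
      qed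
    qed auto
    show "T x < card S" for x
      by (rule T_less)
    show fa: "f c x = a c (T x)" if "c \<in> C" for c x
      using that by (simp add: a_def T_def inv_e hS) (simp add: h_def)
    show "\<bar>a c j\<bar> \<le> b" if c: "c \<in> C" and j: "j < card S" for c j
    proof -
      obtain g where g: "g \<in> S" "e g = j"
        using e j unfolding bij_betw_def by (metis atLeastLessThan_iff imageE le0)
      then obtain x where "j = T x"
        by (auto simp: S_def T_def)
      then show ?thesis
        using bound[OF c, of x] fa[OF c, of x] by simp
    qed
  qed
qed

context finite_poisson_point_process
begin

lemma space_process: "\<omega> \<in> space M \<Longrightarrow> space (N \<omega>) = UNIV"
  using sets_eq_imp_space_eq[OF sets_process] by simp

lemma space_intensity: "space \<Lambda> = UNIV"
  using sets_eq_imp_space_eq[OF sets_intensity] by simp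

lemma finite_process:
  assumes "\<omega> \<in> space M"
  shows "finite_measure (N \<omega>)"
proof (rule finite_measureI)
  obtain k :: nat where "emeasure (N \<omega>) UNIV = of_nat k"
    using nat_valued[OF assms, of UNIV] by auto
  then show "emeasure (N \<omega>) (space (N \<omega>)) \<noteq> \<infinity>"
    using assms by (simp add: space_process)
qed

definition count :: "'x set \<Rightarrow> 'w \<Rightarrow> nat" where
  "count B \<omega> = nat \<lfloor>measure (N \<omega>) B\<rfloor>"

lemma
  assumes "\<omega> \<in> space M" "B \<in> sets borel"
  shows measure_process: "measure (N \<omega>) B = real (count B \<omega>)"
    and emeasure_process: "emeasure (N \<omega>) B = of_nat (count B \<omega>)"
proof -
  obtain k :: nat where k: "emeasure (N \<omega>) B = of_nat k"
    using nat_valued[OF assms] by auto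
  then have "measure (N \<omega>) B = real k"
    by (simp add: measure_def ennreal_of_nat_eq_real_of_nat)
  with k show "measure (N \<omega>) B = real (count B \<omega>)" "emeasure (N \<omega>) B = of_nat (count B \<omega>)"
    by (simp_all add: count_def)
qed

lemma count_eq_iff:
  assumes "\<omega> \<in> space M" "B \<in> sets borel"
  shows "count B \<omega> = k \<longleftrightarrow> emeasure (N \<omega>) B = of_nat k"
  using emeasure_process[OF assms] by simp

lemma measurable_count [measurable]:
  assumes "B \<in> sets borel"
  shows "count B \<in> M \<rightarrow>\<^sub>M count_space UNIV"
proof -
  have [measurable]: "(\<lambda>\<omega>. emeasure (N \<omega>) B) \<in> borel_measurable M"
    by (rule random_measure[OF assms])
  show ?thesis
    unfolding count_def measure_def by measurable
qed

lemma prob_count: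
  assumes "B \<in> sets borel"
  shows "prob {\<omega> \<in> space M. count B \<omega> = k} = measure \<Lambda> B ^ k / fact k * exp (- measure \<Lambda> B)"
proof -
  have "{\<omega> \<in> space M. count B \<omega> = k} = {\<omega> \<in> space M. emeasure (N \<omega>) B = of_nat k}"
    using count_eq_iff[OF _ assms] by auto
  then show ?thesis
    using poisson_distributed[OF assms] by simp
qed

lemma integrable_exp_count:
  assumes B: "B \<in> sets borel"
  shows "integrable M (\<lambda>\<omega>. exp (c * real (count B \<omega>)))"
proof (rule integrableI_nonneg)
  define l where "l = measure \<Lambda> B"
  note [measurable] = measurable_count[OF B]
  show "(\<lambda>\<omega>. exp (c * real (count B \<omega>))) \<in> borel_measurable M"
    by measurable
  define E where "E = (\<lambda>k. {\<omega> \<in> space M. count B \<omega> = k})"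
  have E: "E k \<in> sets M" for k
    unfolding E_def by measurable
  have "(\<integral>\<^sup>+\<omega>. ennreal (exp (c * real (count B \<omega>))) \<partial>M)
      = (\<integral>\<^sup>+\<omega>. (\<Sum>k. ennreal (exp (c * real k)) * indicator (E k) \<omega>) \<partial>M)"
  proof (intro nn_integral_cong)
    fix \<omega> assume "\<omega> \<in> space M"
    then have "\<omega> \<in> E (count B \<omega>)"
      by (simp add: E_def)
    moreover have "disjoint_family E"
      by (auto simp: disjoint_family_on_def E_def)
    ultimately show "ennreal (exp (c * real (count B \<omega>)))
        = (\<Sum>k. ennreal (exp (c * real k)) * indicator (E k) \<omega>)"
      by (intro suminf_cmult_indicator[symmetric])
  qed
  also have "\<dots> = (\<Sum>k. ennreal (exp (c * real k)) * emeasure M (E k))"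
    using E by (subst nn_integral_suminf) (auto simp: nn_integral_cmult_indicator)
  also have "\<dots> = (\<Sum>k. ennreal (exp (- l) * ((exp c * l) ^ k / fact k)))"
  proof (intro arg_cong[where f = suminf] ext)
    fix k
    have "emeasure M (E k) = ennreal (l ^ k / fact k * exp (- l))"
      by (simp add: emeasure_eq_measure E_def prob_count[OF B] l_def)
    moreover have "exp (c * real k) = exp c ^ k"
      by (simp add: exp_of_nat_mult mult.commute[of c])
    ultimately show "ennreal (exp (c * real k)) * emeasure M (E k)
        = ennreal (exp (- l) * ((exp c * l) ^ k / fact k))"
      by (simp add: power_mult_distrib flip: ennreal_mult') (simp add: mult_ac)
  qed
  also have "\<dots> = ennreal (exp (- l) * exp (exp c * l))"
  proof (rule suminf_ennreal_eq)
    have "(\<lambda>k. (exp c * l) ^ k / fact k) sums exp (exp c * l)"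
      using exp_converges[of "exp c * l"] by (simp add: field_simps)
    then show "(\<lambda>k. exp (- l) * ((exp c * l) ^ k / fact k)) sums (exp (- l) * exp (exp c * l))"
      by (rule sums_mult)
  qed (simp add: l_def)
  finally show "(\<integral>\<^sup>+\<omega>. ennreal (exp (c * real (count B \<omega>))) \<partial>M) < \<infinity>"
    by simp
qed auto

text \<open>
  The counts in the cells of a finite measurable partition form a Poisson vector. Its exponential moments
  are those of the total number of points.
\<close>

lemma count_vector_distribution:
  fixes T :: "'x \<Rightarrow> nat" and K :: nat
  assumes T: "T \<in> borel \<rightarrow>\<^sub>M count_space UNIV" "\<And>x. T x < K"
  defines "X \<equiv> (\<lambda>\<omega> j. count (T -` {j}) \<omega>)"
  obtains \<mu> where "X \<in> M \<rightarrow>\<^sub>M count_space UNIV" "measure_pmf \<mu> = distr M (count_space UNIV) X"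
    "poisson_vector \<mu> {..<K} (\<lambda>j. measure \<Lambda> (T -` {j}))"
proof -
  have B: "T -` {j} \<in> sets borel" for j
    using measurable_sets[OF T(1), of "{j}"] by simp
  have K: "K > 0"
    using T(2)[of undefined] by simp
  have B_empty: "T -` {j} = {}" if "\<not> j < K" for j
    using T(2) that by auto
  have X_outside: "X \<omega> j = 0" if "\<not> j < K" for \<omega> j
    using that by (simp add: X_def B_empty count_def)
  define C :: "(nat \<Rightarrow> nat) set" where "C = {k. \<forall>j. \<not> j < K \<longrightarrow> k j = 0}"
  have C: "countable C"
  proof (rule countable_subset)
    show "C \<subseteq> (\<lambda>f j. if j < K then f j else 0) ` (\<Pi>\<^sub>E j\<in>{..<K}. UNIV)"
    proof
      fix k assume "k \<in> C"
      then show "k \<in> (\<lambda>f j. if j < K then f j else 0) ` (\<Pi>\<^sub>E j\<in>{..<K}. UNIV)"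
        by (intro image_eqI[where x = "restrict k {..<K}"]) (auto simp: C_def fun_eq_iff)
    qed
    show "countable ((\<lambda>f j. if j < K then f j else (0::nat)) ` (\<Pi>\<^sub>E j\<in>{..<K}. UNIV))"
      by (intro countable_image countable_PiE) auto
  qed
  have XC: "X \<omega> \<in> C" for \<omega>
    by (simp add: C_def X_outside)
  have X_eq: "{\<omega> \<in> space M. X \<omega> = k} = {\<omega> \<in> space M. \<forall>j\<in>{..<K}. count (T -` {j}) \<omega> = k j}"
    if "k \<in> C" for k
    using that X_outside by (fastforce simp: C_def X_def fun_eq_iff)
  have "X \<in> M \<rightarrow>\<^sub>M count_space C"
  proof (subst measurable_count_space_eq_countable[OF C], intro conjI ballI)
    fix k assume k: "k \<in> C"
    have "{\<omega> \<in> space M. \<forall>j\<in>{..<K}. count (T -` {j}) \<omega> = k j} \<in> sets M"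
      using measurable_count[OF B] by (intro sets.sets_Collect_finite_All) auto
    then show "X -` {k} \<inter> space M \<in> sets M"
      using X_eq[OF k] by (simp add: vimage_def Int_def conj_commute)
  qed (use XC in auto)
  moreover have "(\<lambda>x. x) \<in> count_space C \<rightarrow>\<^sub>M count_space UNIV"
    by simp
  ultimately have X [measurable]: "X \<in> M \<rightarrow>\<^sub>M count_space UNIV"
    by (rule measurable_compose)
  define P where "P = distr M (count_space UNIV) X"
  interpret P: prob_space P
    unfolding P_def by (rule prob_space_distr[OF X])
  have "AE k in P. k \<in> C"
    unfolding P_def by (subst AE_distr_iff) (use XC in auto)
  then have "AE k in P. measure P {k} \<noteq> 0"
    using C by (subst P.AE_support_countable) (auto simp: P_def)
  moreover have "sets P = UNIV"
    by (simp add: P_def)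
  ultimately have "P \<in> {M. prob_space M \<and> sets M = UNIV \<and> (AE x in M. measure M {x} \<noteq> 0)}"
    using P.prob_space_axioms by simp
  then have \<mu>: "measure_pmf (Abs_pmf P) = P"
    by (rule Abs_pmf_inverse)
  show thesis
  proof (rule that[OF X])
    show "measure_pmf (Abs_pmf P) = distr M (count_space UNIV) X"
      using \<mu> unfolding P_def .
    show "poisson_vector (Abs_pmf P) {..<K} (\<lambda>j. measure \<Lambda> (T -` {j}))"
    proof
      fix k
      have "pmf (Abs_pmf P) k = prob (X -` {k} \<inter> space M)"
        unfolding pmf.rep_eq \<mu> unfolding P_def by (subst measure_distr) auto
      also have "X -` {k} \<inter> space M = {\<omega> \<in> space M. X \<omega> = k}"
        by auto
      also have "prob {\<omega> \<in> space M. X \<omega> = k} = (if \<forall>j. j \<notin> {..<K} \<longrightarrow> k j = 0 then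
          \<Prod>j<K. measure \<Lambda> (T -` {j}) ^ k j / fact (k j) * exp (- measure \<Lambda> (T -` {j})) else 0)"
      proof (cases "k \<in> C")
        case True
        define Y where "Y = (\<lambda>j \<omega>. emeasure (N \<omega>) (T -` {j}))"
        have ind: "indep_vars (\<lambda>_. borel) Y {..<K}"
          unfolding Y_def using B by (intro independent_on_disjoint) (auto simp: disjoint_family_on_def)
        have "{\<omega> \<in> space M. X \<omega> = k} = (\<Inter>j\<in>{..<K}. Y j -` {of_nat (k j)} \<inter> space M)"
          unfolding X_eq[OF True] using K count_eq_iff[OF _ B] by (auto simp: Y_def)
        also have "prob \<dots> = (\<Prod>j<K. prob (Y j -` {of_nat (k j)} \<inter> space M))"
          using K by (intro indep_varsD_finite[OF ind]) auto
        also have "\<dots> = (\<Prod>j<K. measure \<Lambda> (T -` {j}) ^ k j / fact (k j) * exp (- measure \<Lambda> (T -` {j})))"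
        proof (intro prod.cong refl)
          fix j
          have "Y j -` {of_nat (k j)} \<inter> space M = {\<omega> \<in> space M. emeasure (N \<omega>) (T -` {j}) = of_nat (k j)}"
            by (auto simp: Y_def)
          then show "prob (Y j -` {of_nat (k j)} \<inter> space M)
              = measure \<Lambda> (T -` {j}) ^ k j / fact (k j) * exp (- measure \<Lambda> (T -` {j}))"
            using poisson_distributed[OF B] by simp
        qed
        finally show ?thesis
          using True by (auto simp: C_def)
      next
        case False
        then have "{\<omega> \<in> space M. X \<omega> = k} = {}"
          using XC by auto
        then have "prob {\<omega> \<in> space M. X \<omega> = k} = 0"
          by (simp only: measure_empty)
        then show ?thesis
          using False by (auto simp: C_def)
      qed
      finally show "pmf (Abs_pmf P) k = (if \<forall>j. j \<notin> {..<K} \<longrightarrow> k j = 0 then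
          \<Prod>j<K. measure \<Lambda> (T -` {j}) ^ k j / fact (k j) * exp (- measure \<Lambda> (T -` {j})) else 0)" .
    next
      fix c :: real
      have total: "(\<Sum>j<K. real (X \<omega> j)) = real (count UNIV \<omega>)" if "\<omega> \<in> space M" for \<omega>
      proof -
        have "(\<Sum>j<K. 1 * measure (N \<omega>) (T -` {j})) = (\<integral>x. 1 \<partial>(N \<omega>))"
          using integral_step_function[OF finite_process[OF that] sets_process[OF that] T, of "\<lambda>_. 1"]
          by simp
        then show ?thesis
          using that by (simp add: X_def measure_process B space_process)
      qed
      have "integrable M (\<lambda>\<omega>. exp (c * (\<Sum>j<K. real (X \<omega> j))))"
        using integrable_exp_count[of UNIV c]
        by (subst Bochner_Integration.integrable_cong[OF refl]) (auto simp: total)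
      then show "integrable (measure_pmf (Abs_pmf P)) (\<lambda>k. exp (c * (\<Sum>j<K. real (k j))))"
        unfolding \<mu> unfolding P_def by (subst integrable_distr_eq[OF X]) auto
    qed auto
  qed
qed

end

section \<open>Suprema of compensated Poisson integrals\<close>

context finite_poisson_point_process
begin

lemma vimage_count_space_borel:
  fixes T :: "'x \<Rightarrow> nat"
  assumes "T \<in> borel \<rightarrow>\<^sub>M count_space UNIV"
  shows "T -` {j} \<in> sets borel"
  using measurable_sets[OF assms, of "{j}"] by simp

lemma compensated_integral_step_function:
  fixes T :: "'x \<Rightarrow> nat" and a :: "nat \<Rightarrow> real"
  assumes "\<omega> \<in> space M" and T: "T \<in> borel \<rightarrow>\<^sub>M count_space UNIV" "\<And>x. T x < K"
  shows "compensated_integral \<Lambda> N (\<lambda>x. a (T x)) \<omega>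
    = (\<Sum>j<K. a j * (real (count (T -` {j}) \<omega>) - measure \<Lambda> (T -` {j})))"
proof -
  note integral_N = integral_step_function[OF finite_process[OF assms(1)] sets_process[OF assms(1)] T, of a]
  note integral_L = integral_step_function[OF intensity.finite_measure_axioms sets_intensity T, of a]
  show ?thesis
    unfolding compensated_integral_def integral_N integral_L
    by (simp add: measure_process[OF assms(1) vimage_count_space_borel[OF T(1)]]
        right_diff_distrib sum_subtractf)
qed

text \<open>
  Functions with finite ranges turn the compensated integrals into linear statistics of a Poisson vector,
  so that the results for Poisson vectors carry over.
\<close>

lemma finite_range_compensated_integrals:
  fixes f :: "'c \<Rightarrow> 'x \<Rightarrow> real"
  assumes C: "finite C" "C \<noteq> {}"
    and f: "\<And>c. c \<in> C \<Longrightarrow> f c \<in> borel_measurable borel" "\<And>c. c \<in> C \<Longrightarrow> finite (range (f c))"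
      "\<And>c x. c \<in> C \<Longrightarrow> \<bar>f c x\<bar> \<le> 1"
    and v: "\<And>c. c \<in> C \<Longrightarrow> (\<integral>x. (f c x)\<^sup>2 \<partial>\<Lambda>) \<le> v"
    and t: "0 \<le> t"
  defines "Z \<equiv> (\<lambda>\<omega>. MAX c\<in>C. compensated_integral \<Lambda> N (f c) \<omega>)"
  shows "Z \<in> borel_measurable M"
    and "ln (expectation (\<lambda>\<omega>. exp (t * Z \<omega>)))
      \<le> t * expectation Z + t / 2 * (2 * expectation Z + v) * (exp (exp t - 1) - 1)"
    and "c \<in> C \<Longrightarrow> expectation (compensated_integral \<Lambda> N (f c)) = 0"
    and "c \<in> C \<Longrightarrow> expectation (\<lambda>\<omega>. (compensated_integral \<Lambda> N (f c) \<omega>)\<^sup>2) = (\<integral>x. (f c x)\<^sup>2 \<partial>\<Lambda>)"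
proof -
  obtain T :: "'x \<Rightarrow> nat" and K and a :: "'c \<Rightarrow> nat \<Rightarrow> real" where
    T: "T \<in> borel \<rightarrow>\<^sub>M count_space UNIV" "\<And>x. T x < K"
    and fa: "\<And>c x. c \<in> C \<Longrightarrow> f c x = a c (T x)"
    and a: "\<And>c j. c \<in> C \<Longrightarrow> j < K \<Longrightarrow> \<bar>a c j\<bar> \<le> 1"
    using finite_range_functions_factor_through_nat[where C = C and f = f and b = 1, OF C(1) f] by blast
  define X where "X = (\<lambda>\<omega> j. count (T -` {j}) \<omega>)"
  define r where "r = (\<lambda>j. measure \<Lambda> (T -` {j}))"
  obtain \<mu> where X: "X \<in> M \<rightarrow>\<^sub>M count_space UNIV"
    and \<mu>: "measure_pmf \<mu> = distr M (count_space UNIV) X"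
    and vec: "poisson_vector \<mu> {..<K} r"
    using count_vector_distribution[OF T] unfolding X_def r_def by blast
  interpret poisson_vector \<mu> "{..<K}" r
    by (rule vec)
  define I where "I = (\<lambda>c k. \<Sum>j<K. a c j * (real (k j) - r j))"
  define Z' where "Z' = (\<lambda>k. MAX c\<in>C. I c k)"
  have I: "compensated_integral \<Lambda> N (f c) \<omega> = I c (X \<omega>)" if "c \<in> C" "\<omega> \<in> space M" for c \<omega>
  proof -
    have "f c = (\<lambda>x. a c (T x))"
      using fa[OF that(1)] by auto
    then show ?thesis
      using compensated_integral_step_function[OF that(2) T, of "a c"] by (simp add: I_def X_def r_def)
  qed
  then have Z: "Z \<omega> = Z' (X \<omega>)" if "\<omega> \<in> space M" for \<omega>
    unfolding Z_def Z'_def using that by (simp cong: image_cong_simp)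
  have E: "expectation g = measure_pmf.expectation \<mu> h"
    if "\<And>\<omega>. \<omega> \<in> space M \<Longrightarrow> g \<omega> = h (X \<omega>)" for g h :: "_ \<Rightarrow> real"
    unfolding \<mu> using that by (subst integral_distr[OF X]) (auto intro!: Bochner_Integration.integral_cong)
  have "(\<lambda>\<omega>. Z' (X \<omega>)) \<in> borel_measurable M"
    by (rule measurable_compose[OF X]) simp
  then show "Z \<in> borel_measurable M"
    by (subst measurable_cong[OF Z])
  have sq: "(\<integral>x. (f c x)\<^sup>2 \<partial>\<Lambda>) = (\<Sum>j<K. r j * (a c j)\<^sup>2)" if "c \<in> C" for c
    using integral_step_function[OF intensity.finite_measure_axioms sets_intensity T, of "\<lambda>j. (a c j)\<^sup>2"] that
    by (simp add: fa r_def mult.commute)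
  have "ln (measure_pmf.expectation \<mu> (\<lambda>k. exp (t * Z' k)))
      \<le> t * measure_pmf.expectation \<mu> Z'
        + t / 2 * (2 * measure_pmf.expectation \<mu> Z' + v) * (exp (exp t - 1) - 1)"
    unfolding Z'_def I_def using a v by (intro ln_mgf_max_le C t) (auto simp: sq)
  moreover have "expectation Z = measure_pmf.expectation \<mu> Z'"
    by (intro E Z)
  moreover have "expectation (\<lambda>\<omega>. exp (t * Z \<omega>)) = measure_pmf.expectation \<mu> (\<lambda>k. exp (t * Z' k))"
    by (intro E) (simp add: Z)
  ultimately show "ln (expectation (\<lambda>\<omega>. exp (t * Z \<omega>)))
      \<le> t * expectation Z + t / 2 * (2 * expectation Z + v) * (exp (exp t - 1) - 1)"
    by simp
  assume c: "c \<in> C"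
  have "expectation (compensated_integral \<Lambda> N (f c)) = measure_pmf.expectation \<mu> (I c)"
    by (intro E I c)
  then show "expectation (compensated_integral \<Lambda> N (f c)) = 0"
    using linear_statistic_moments(1)[of "a c"] a[OF c] by (simp add: I_def)
  have "expectation (\<lambda>\<omega>. (compensated_integral \<Lambda> N (f c) \<omega>)\<^sup>2) = measure_pmf.expectation \<mu> (\<lambda>k. (I c k)\<^sup>2)"
    by (intro E) (simp add: I c)
  then show "expectation (\<lambda>\<omega>. (compensated_integral \<Lambda> N (f c) \<omega>)\<^sup>2) = (\<integral>x. (f c x)\<^sup>2 \<partial>\<Lambda>)"
    using linear_statistic_moments(2)[of "a c"] a[OF c] by (simp add: I_def sq[OF c])
qed

text \<open>
  An envelope: it bounds all compensated integrals of functions with values in \<open>{-1..1}\<close>, and all its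
  exponential moments are finite, so it serves as the dominating function in every passage to the limit.
\<close>

definition total_mass :: "'w \<Rightarrow> real" where
  "total_mass \<omega> = real (count UNIV \<omega>) + measure \<Lambda> UNIV"

lemma total_mass_nonneg: "0 \<le> total_mass \<omega>"
  by (simp add: total_mass_def)

lemma integrable_exp_total_mass_dominated:
  fixes f :: "'w \<Rightarrow> real"
  assumes f: "f \<in> borel_measurable M" "\<And>\<omega>. \<omega> \<in> space M \<Longrightarrow> \<bar>f \<omega>\<bar> \<le> exp (c * total_mass \<omega>)"
  shows "integrable M f"
proof (rule Bochner_Integration.integrable_bound)
  show "integrable M (\<lambda>\<omega>. exp (c * measure \<Lambda> UNIV) * exp (c * real (count UNIV \<omega>)))"
    by (intro integrable_mult_right integrable_exp_count) simp
  show "AE \<omega> in M. norm (f \<omega>) \<le> norm (exp (c * measure \<Lambda> UNIV) * exp (c * real (count UNIV \<omega>)))"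
    using f(2) by (intro AE_I2) (simp add: total_mass_def algebra_simps flip: exp_add)
qed (rule f)

lemma total_mass_le_exp: "total_mass \<omega> \<le> exp (1 * total_mass \<omega>)"
proof -
  have "1 + total_mass \<omega> \<le> exp (total_mass \<omega>)"
    by (rule exp_ge_add_one_self)
  then show ?thesis
    unfolding mult_1_left by linarith
qed

lemma integrable_exp_total_mass: "integrable M (\<lambda>\<omega>. exp (c * total_mass \<omega>))"
proof (rule integrable_exp_total_mass_dominated[where c = c])
  show "(\<lambda>\<omega>. exp (c * total_mass \<omega>)) \<in> borel_measurable M"
    unfolding total_mass_def using measurable_count[of UNIV] by measurable
qed simp

lemma compensated_integral_diff_le:
  assumes \<omega>: "\<omega> \<in> space M"
    and f: "f \<in> borel_measurable borel" "\<And>x. \<bar>f x\<bar> \<le> 1"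
    and g: "g \<in> borel_measurable borel" "\<And>x. \<bar>g x\<bar> \<le> 1"
    and fg: "\<And>x. \<bar>f x - g x\<bar> \<le> \<delta>"
  shows "\<bar>compensated_integral \<Lambda> N f \<omega> - compensated_integral \<Lambda> N g \<omega>\<bar> \<le> \<delta> * total_mass \<omega>"
proof -
  have *: "\<bar>(\<integral>x. f x \<partial>\<nu>) - (\<integral>x. g x \<partial>\<nu>)\<bar> \<le> \<delta> * measure \<nu> UNIV"
    if "finite_measure \<nu>" "sets \<nu> = sets borel" for \<nu>
  proof -
    interpret finite_measure \<nu>
      by fact
    have sp: "space \<nu> = UNIV"
      using sets_eq_imp_space_eq[OF that(2)] by simp
    have meas: "f \<in> borel_measurable \<nu>" "g \<in> borel_measurable \<nu>"
      using f(1) g(1) by (simp_all add: measurable_cong_sets[OF that(2) refl])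
    have int: "integrable \<nu> f" "integrable \<nu> g"
      using f(2) g(2) meas by (auto intro!: integrable_const_bound[where B = 1])
    then have "\<bar>(\<integral>x. f x \<partial>\<nu>) - (\<integral>x. g x \<partial>\<nu>)\<bar> = \<bar>\<integral>x. f x - g x \<partial>\<nu>\<bar>"
      by simp
    also have "\<dots> \<le> (\<integral>x. \<bar>f x - g x\<bar> \<partial>\<nu>)"
      by (rule integral_abs_bound)
    also have "\<dots> \<le> (\<integral>x. \<delta> \<partial>\<nu>)"
      using int fg by (intro integral_mono) auto
    finally show ?thesis
      by (simp add: sp mult.commute)
  qed
  have "\<bar>compensated_integral \<Lambda> N f \<omega> - compensated_integral \<Lambda> N g \<omega>\<bar>
      \<le> \<bar>(\<integral>x. f x \<partial>(N \<omega>)) - (\<integral>x. g x \<partial>(N \<omega>))\<bar> + \<bar>(\<integral>x. f x \<partial>\<Lambda>) - (\<integral>x. g x \<partial>\<Lambda>)\<bar>"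
    unfolding compensated_integral_def by linarith
  also have "\<dots> \<le> \<delta> * measure (N \<omega>) UNIV + \<delta> * measure \<Lambda> UNIV"
    using \<omega> by (intro add_mono * finite_process sets_process sets_intensity intensity.finite_measure_axioms)
  finally show ?thesis
    using \<omega> by (simp add: total_mass_def measure_process algebra_simps)
qed

lemma abs_compensated_integral_le:
  assumes "\<omega> \<in> space M" "f \<in> borel_measurable borel" "\<And>x. \<bar>f x\<bar> \<le> 1"
  shows "\<bar>compensated_integral \<Lambda> N f \<omega>\<bar> \<le> total_mass \<omega>"
  using compensated_integral_diff_le[OF assms, of "\<lambda>_. 0" 1] assms
  by (simp add: compensated_integral_def)

end

text \<open>
  Rounding down to a multiple of \<open>1 / (n + 1)\<close>. The ends \<open>-1\<close> and \<open>1\<close> are such multiples, so that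
  rounding does not leave the interval \<open>{-1..1}\<close>.
\<close>

definition quantize :: "nat \<Rightarrow> ('x \<Rightarrow> real) \<Rightarrow> 'x \<Rightarrow> real" where
  "quantize n f x = real_of_int \<lfloor>real (Suc n) * f x\<rfloor> / real (Suc n)"

lemma const_over_Suc_times_tendsto_0: "(\<lambda>n. c / real (Suc n) * d) \<longlonglongrightarrow> (0 :: real)"
  by (intro tendsto_mult_left_zero LIMSEQ_Suc lim_const_over_n)

lemma quantize_close: "\<bar>quantize n f x - f x\<bar> \<le> 1 / real (Suc n)"
proof -
  have "\<bar>real_of_int \<lfloor>real (Suc n) * f x\<rfloor> - real (Suc n) * f x\<bar> \<le> 1"
    by linarith
  moreover have "quantize n f x - f x
      = (real_of_int \<lfloor>real (Suc n) * f x\<rfloor> - real (Suc n) * f x) / real (Suc n)"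
    by (simp add: quantize_def diff_divide_distrib del: of_nat_Suc)
  ultimately show ?thesis
    by (simp add: abs_divide divide_right_mono del: of_nat_Suc)
qed

lemma floor_scaled_bounds:
  assumes "\<bar>f x\<bar> \<le> 1"
  shows "\<lfloor>real (Suc n) * f x\<rfloor> \<in> {- int (Suc n)..int (Suc n)}"
proof -
  have "real (Suc n) * f x \<le> real (Suc n) * 1" "real (Suc n) * (- 1) \<le> real (Suc n) * f x"
    using assms by (intro mult_left_mono; simp)+
  then have "\<lfloor>real (Suc n) * f x\<rfloor> \<le> \<lfloor>real_of_int (int (Suc n))\<rfloor>"
    "\<lfloor>real_of_int (- int (Suc n))\<rfloor> \<le> \<lfloor>real (Suc n) * f x\<rfloor>"
    by (intro floor_mono; simp only: of_int_minus of_int_of_nat_eq mult_1_right mult_minus_right)+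
  then show ?thesis
    unfolding floor_of_int by simp
qed

lemma abs_quantize_le:
  assumes "\<And>x. \<bar>f x\<bar> \<le> 1"
  shows "\<bar>quantize n f x\<bar> \<le> 1"
  using floor_scaled_bounds[of f x n, OF assms]
  by (auto simp: quantize_def abs_le_iff field_simps)

lemma finite_range_quantize:
  assumes "\<And>x. \<bar>f x\<bar> \<le> 1"
  shows "finite (range (quantize n f))"
proof (rule finite_subset)
  show "range (quantize n f) \<subseteq> (\<lambda>i. real_of_int i / real (Suc n)) ` {- int (Suc n)..int (Suc n)}"
    using floor_scaled_bounds[of f _ n, OF assms] unfolding quantize_def by blast
qed simp

lemma measurable_quantize:
  assumes [measurable]: "f \<in> borel_measurable borel"
  shows "quantize n f \<in> borel_measurable borel"
  unfolding quantize_def by measurable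

context finite_poisson_point_process
begin

lemma integral_quantize_square_le:
  assumes [measurable]: "f \<in> borel_measurable borel" and f: "\<And>x. \<bar>f x\<bar> \<le> 1"
  shows "\<bar>(\<integral>x. (quantize n f x)\<^sup>2 \<partial>\<Lambda>) - (\<integral>x. (f x)\<^sup>2 \<partial>\<Lambda>)\<bar> \<le> 2 / real (Suc n) * measure \<Lambda> UNIV"
proof -
  have [measurable]: "f \<in> borel_measurable \<Lambda>" "quantize n f \<in> borel_measurable \<Lambda>"
    using assms(1) measurable_quantize[OF assms(1)]
    by (simp_all add: measurable_cong_sets[OF sets_intensity refl])
  note q = abs_quantize_le[of f, OF f]
  have int: "integrable \<Lambda> (\<lambda>x. (f x)\<^sup>2)" "integrable \<Lambda> (\<lambda>x. (quantize n f x)\<^sup>2)"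
    using f q by (auto intro!: intensity.integrable_const_bound[where B = 1] simp: abs_square_le_1)
  then have "\<bar>(\<integral>x. (quantize n f x)\<^sup>2 \<partial>\<Lambda>) - (\<integral>x. (f x)\<^sup>2 \<partial>\<Lambda>)\<bar>
      = \<bar>\<integral>x. (quantize n f x)\<^sup>2 - (f x)\<^sup>2 \<partial>\<Lambda>\<bar>"
    by simp
  also have "\<dots> \<le> (\<integral>x. \<bar>(quantize n f x)\<^sup>2 - (f x)\<^sup>2\<bar> \<partial>\<Lambda>)"
    by (rule integral_abs_bound)
  also have "\<dots> \<le> (\<integral>x. 2 / real (Suc n) \<partial>\<Lambda>)"
  proof (intro integral_mono)
    fix x
    have "\<bar>(quantize n f x)\<^sup>2 - (f x)\<^sup>2\<bar> = \<bar>quantize n f x + f x\<bar> * \<bar>quantize n f x - f x\<bar>"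
      by (simp add: power2_eq_square algebra_simps flip: abs_mult)
    also have "\<dots> \<le> 2 * (1 / real (Suc n))"
      using f[of x] q[of n x] by (intro mult_mono quantize_close) auto
    finally show "\<bar>(quantize n f x)\<^sup>2 - (f x)\<^sup>2\<bar> \<le> 2 / real (Suc n)"
      by simp
  qed (use int in auto)
  finally show ?thesis
    by (simp add: space_intensity mult.commute)
qed

lemma quantized_compensated_integral_tendsto:
  assumes "\<omega> \<in> space M" "f \<in> borel_measurable borel" "\<And>x. \<bar>f x\<bar> \<le> 1"
  shows "(\<lambda>n. compensated_integral \<Lambda> N (quantize n f) \<omega>) \<longlonglongrightarrow> compensated_integral \<Lambda> N f \<omega>"
proof (rule LIM_zero_cancel, rule Lim_transform_bound)
  show "\<forall>\<^sub>F n in sequentially. norm (compensated_integral \<Lambda> N (quantize n f) \<omega> - compensated_integral \<Lambda> N f \<omega>)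
      \<le> norm (1 / real (Suc n) * total_mass \<omega>)"
    using compensated_integral_diff_le[OF assms(1) measurable_quantize[OF assms(2)]
        abs_quantize_le[OF assms(3)] assms(2,3) quantize_close] total_mass_nonneg[of \<omega>]
    by (intro always_eventually allI) simp
  show "(\<lambda>n. 1 / real (Suc n) * total_mass \<omega>) \<longlonglongrightarrow> 0"
    by (rule const_over_Suc_times_tendsto_0)
qed

lemma compensated_integral_moments:
  assumes f: "f \<in> borel_measurable borel" "\<And>x. \<bar>f x\<bar> \<le> 1"
  shows "compensated_integral \<Lambda> N f \<in> borel_measurable M"
    and "expectation (compensated_integral \<Lambda> N f) = 0"
    and "expectation (\<lambda>\<omega>. (compensated_integral \<Lambda> N f \<omega>)\<^sup>2) = (\<integral>x. (f x)\<^sup>2 \<partial>\<Lambda>)"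
proof -
  define I where "I = (\<lambda>n. compensated_integral \<Lambda> N (quantize n f))"
  have q: "quantize n f \<in> borel_measurable borel" "finite (range (quantize n f))"
    "\<bar>quantize n f x\<bar> \<le> 1" for n x
    by (rule measurable_quantize[OF f(1)] finite_range_quantize[OF f(2)] abs_quantize_le[OF f(2)])+
  have step: "I n \<in> borel_measurable M" "expectation (I n) = 0"
    "expectation (\<lambda>\<omega>. (I n \<omega>)\<^sup>2) = (\<integral>x. (quantize n f x)\<^sup>2 \<partial>\<Lambda>)" for n
    using finite_range_compensated_integrals[where C = "{()}" and f = "\<lambda>_. quantize n f" and t = 0, OF _ _ q order_refl]
    by (simp_all add: I_def)
  have lim: "(\<lambda>n. I n \<omega>) \<longlonglongrightarrow> compensated_integral \<Lambda> N f \<omega>" if "\<omega> \<in> space M" for \<omega>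
    unfolding I_def by (rule quantized_compensated_integral_tendsto[OF that f])
  have I_le: "\<bar>I n \<omega>\<bar> \<le> total_mass \<omega>" if "\<omega> \<in> space M" for n \<omega>
    unfolding I_def by (rule abs_compensated_integral_le[OF that q(1,3)])
  show meas: "compensated_integral \<Lambda> N f \<in> borel_measurable M"
    by (rule borel_measurable_LIMSEQ_real[OF lim step(1)])
  have "(\<lambda>n. expectation (I n)) \<longlonglongrightarrow> expectation (compensated_integral \<Lambda> N f)"
  proof (rule integral_dominated_convergence[where w = "\<lambda>\<omega>. exp (1 * total_mass \<omega>)"])
    show "AE \<omega> in M. norm (I n \<omega>) \<le> exp (1 * total_mass \<omega>)" for n
      using I_le total_mass_le_exp by (intro AE_I2) (auto intro: order_trans)
  qed (use meas step lim integrable_exp_total_mass[of 1] in \<open>auto intro!: AE_I2\<close>)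
  then show "expectation (compensated_integral \<Lambda> N f) = 0"
    using LIMSEQ_unique[OF _ tendsto_const] by (auto simp: step)
  have "(\<lambda>n. expectation (\<lambda>\<omega>. (I n \<omega>)\<^sup>2)) \<longlonglongrightarrow> expectation (\<lambda>\<omega>. (compensated_integral \<Lambda> N f \<omega>)\<^sup>2)"
  proof (rule integral_dominated_convergence[where w = "\<lambda>\<omega>. exp (2 * total_mass \<omega>)"])
    show "AE \<omega> in M. norm ((I n \<omega>)\<^sup>2) \<le> exp (2 * total_mass \<omega>)" for n
    proof (intro AE_I2)
      fix \<omega> assume "\<omega> \<in> space M"
      then have "\<bar>I n \<omega>\<bar> \<le> exp (1 * total_mass \<omega>)"
        using I_le total_mass_le_exp order_trans by blast
      then have "\<bar>I n \<omega>\<bar>\<^sup>2 \<le> exp (1 * total_mass \<omega>) ^ 2"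
        by (intro power_mono) auto
      then show "norm ((I n \<omega>)\<^sup>2) \<le> exp (2 * total_mass \<omega>)"
        by (simp add: power2_eq_square flip: exp_add)
    qed
    show "(\<lambda>\<omega>. (compensated_integral \<Lambda> N f \<omega>)\<^sup>2) \<in> borel_measurable M"
      using meas by measurable
    show "(\<lambda>\<omega>. (I n \<omega>)\<^sup>2) \<in> borel_measurable M" for n
      using step(1)[of n] by measurable
  qed (use lim integrable_exp_total_mass in \<open>auto intro!: AE_I2 tendsto_power\<close>)
  moreover have "(\<lambda>n. expectation (\<lambda>\<omega>. (I n \<omega>)\<^sup>2)) \<longlonglongrightarrow> (\<integral>x. (f x)\<^sup>2 \<partial>\<Lambda>)"
    unfolding step
  proof (rule LIM_zero_cancel, rule Lim_transform_bound)
    show "\<forall>\<^sub>F n in sequentially. norm ((\<integral>x. (quantize n f x)\<^sup>2 \<partial>\<Lambda>) - (\<integral>x. (f x)\<^sup>2 \<partial>\<Lambda>))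
        \<le> norm (2 / real (Suc n) * measure \<Lambda> UNIV)"
      using integral_quantize_square_le[OF f] by (intro always_eventually allI) simp
    show "(\<lambda>n. 2 / real (Suc n) * measure \<Lambda> UNIV) \<longlonglongrightarrow> 0"
      by (rule const_over_Suc_times_tendsto_0)
  qed
  ultimately show "expectation (\<lambda>\<omega>. (compensated_integral \<Lambda> N f \<omega>)\<^sup>2) = (\<integral>x. (f x)\<^sup>2 \<partial>\<Lambda>)"
    by (rule LIMSEQ_unique)
qed

text \<open>
  Rounding at level \<open>m\<close> and keeping only the first \<open>m + 1\<close> functions gives maxima that converge pointwise
  to the supremum, and the bound for finite ranges passes to the limit; rounding changes the second
  moments by at most \<open>2 / (m + 1)\<close> times the total intensity.
\<close>

theorem ln_mgf_sup_compensated_integral_le: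
  fixes s :: "nat \<Rightarrow> 'x \<Rightarrow> real"
  assumes s: "\<And>i. s i \<in> borel_measurable borel" "\<And>i x. \<bar>s i x\<bar> \<le> 1"
    and v: "\<And>i. (\<integral>x. (s i x)\<^sup>2 \<partial>\<Lambda>) \<le> v"
    and t: "0 \<le> t"
  defines "Z \<equiv> (\<lambda>\<omega>. SUP i. compensated_integral \<Lambda> N (s i) \<omega>)"
  shows "ln (expectation (\<lambda>\<omega>. exp (t * Z \<omega>)))
      \<le> t * expectation Z + t / 2 * (2 * expectation Z + v) * (exp (exp t - 1) - 1)"
    and "integrable M Z" and "integrable M (\<lambda>\<omega>. exp (t * Z \<omega>))"
proof -
  define I where "I = (\<lambda>i. compensated_integral \<Lambda> N (s i))"
  define J where "J = (\<lambda>m i. compensated_integral \<Lambda> N (quantize m (s i)))"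
  define Zm where "Zm = (\<lambda>m \<omega>. MAX i\<in>{..m}. J m i \<omega>)"
  have q: "quantize n (s i) \<in> borel_measurable borel" "finite (range (quantize n (s i)))"
    "\<bar>quantize n (s i) x\<bar> \<le> 1" for n i x
    by (rule measurable_quantize[OF s(1)] finite_range_quantize[OF s(2)] abs_quantize_le[OF s(2)])+
  have bound: "(\<integral>x. (quantize m (s i) x)\<^sup>2 \<partial>\<Lambda>) \<le> v + 2 / real (Suc m) * measure \<Lambda> UNIV" for m i
    using integral_quantize_square_le[of "s i" m, OF s] v[of i] by linarith
  have Zm: "Zm m \<in> borel_measurable M"
    "ln (expectation (\<lambda>\<omega>. exp (t * Zm m \<omega>))) \<le> t * expectation (Zm m) +
      t / 2 * (2 * expectation (Zm m) + (v + 2 / real (Suc m) * measure \<Lambda> UNIV)) * (exp (exp t - 1) - 1)" for m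
    unfolding Zm_def J_def
    by (rule finite_range_compensated_integrals[where C = "{..m}" and f = "\<lambda>i. quantize m (s i)", OF _ _ q bound t];
        simp)+
  have I_le: "\<bar>I i \<omega>\<bar> \<le> total_mass \<omega>" and J_le: "\<bar>J m i \<omega>\<bar> \<le> total_mass \<omega>"
    and IJ: "\<bar>J m i \<omega> - I i \<omega>\<bar> \<le> 1 / real (Suc m) * total_mass \<omega>" if "\<omega> \<in> space M" for m i \<omega>
    unfolding I_def J_def
    using abs_compensated_integral_le[OF that s(1) s(2)] abs_compensated_integral_le[OF that q(1,3)]
      compensated_integral_diff_le[OF that q(1,3) s(1) s(2) quantize_close] by auto
  have bdd: "bdd_above (range (\<lambda>i. I i \<omega>))" if "\<omega> \<in> space M" for \<omega>
    using I_le[OF that] by (intro bdd_aboveI[of _ "total_mass \<omega>"]) (auto simp: abs_le_iff)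
  have I_le_Z: "I i \<omega> \<le> Z \<omega>" if "\<omega> \<in> space M" for i \<omega>
    unfolding Z_def I_def using bdd[OF that] by (intro cSUP_upper) (auto simp: I_def)
  have J_le_Zm: "J m i \<omega> \<le> Zm m \<omega>" if "i \<le> m" for m i \<omega>
    unfolding Zm_def using that by (intro Max_ge) auto
  have "\<exists>i. i \<le> m \<and> Zm m \<omega> = J m i \<omega>" for m \<omega>
  proof -
    have "Zm m \<omega> \<in> (\<lambda>i. J m i \<omega>) ` {..m}"
      unfolding Zm_def by (intro Max_in) auto
    then show ?thesis
      by auto
  qed
  then obtain im where im: "\<And>m \<omega>. im m \<omega> \<le> m" "\<And>m \<omega>. Zm m \<omega> = J m (im m \<omega>) \<omega>"
    by metis
  have Zm_abs: "\<bar>Zm m \<omega>\<bar> \<le> total_mass \<omega>" if "\<omega> \<in> space M" for m \<omega>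
    unfolding im(2) by (rule J_le[OF that])
  have lim: "(\<lambda>m. Zm m \<omega>) \<longlonglongrightarrow> Z \<omega>" if \<omega>: "\<omega> \<in> space M" for \<omega>
  proof (rule order_tendstoI)
    fix b assume "b < Z \<omega>"
    then obtain i where i: "b < I i \<omega>"
      using less_cSUP_iff[OF _ bdd[OF \<omega>]] unfolding Z_def I_def by auto
    have "(\<lambda>m. I i \<omega> - 1 / real (Suc m) * total_mass \<omega>) \<longlonglongrightarrow> I i \<omega>"
      using tendsto_diff[OF tendsto_const const_over_Suc_times_tendsto_0, of "I i \<omega>" 1] by simp
    then have "\<forall>\<^sub>F m in sequentially. b < I i \<omega> - 1 / real (Suc m) * total_mass \<omega>"
      using i by (rule order_tendstoD)
    then show "\<forall>\<^sub>F m in sequentially. b < Zm m \<omega>"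
      using eventually_ge_at_top[of i]
    proof eventually_elim
      case (elim m)
      then show ?case
        using IJ[OF \<omega>, of m i] J_le_Zm[of i m \<omega>] by linarith
    qed
  next
    fix b assume "Z \<omega> < b"
    have "(\<lambda>m. Z \<omega> + 1 / real (Suc m) * total_mass \<omega>) \<longlonglongrightarrow> Z \<omega>"
      using tendsto_add[OF tendsto_const const_over_Suc_times_tendsto_0, of "Z \<omega>" 1] by simp
    then have "\<forall>\<^sub>F m in sequentially. Z \<omega> + 1 / real (Suc m) * total_mass \<omega> < b"
      using \<open>Z \<omega> < b\<close> by (rule order_tendstoD)
    then show "\<forall>\<^sub>F m in sequentially. Zm m \<omega> < b"
    proof eventually_elim
      case (elim m)
      then show ?case
        using IJ[OF \<omega>, of m "im m \<omega>"] I_le_Z[OF \<omega>, of "im m \<omega>"] im(2)[of m \<omega>] by linarith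
    qed
  qed
  have Z_meas [measurable]: "Z \<in> borel_measurable M"
    by (rule borel_measurable_LIMSEQ_real[OF lim Zm(1)])
  have Z_abs: "\<bar>Z \<omega>\<bar> \<le> total_mass \<omega>" if "\<omega> \<in> space M" for \<omega>
    using tendsto_rabs[OF lim[OF that]] Zm_abs[OF that] by (intro LIMSEQ_le_const2) auto
  show "integrable M Z"
    using Z_abs total_mass_le_exp order_trans
    by (intro integrable_exp_total_mass_dominated[of _ 1]) (auto simp del: mult_1_left, blast)
  have exp_le: "exp (t * z) \<le> exp (t * total_mass \<omega>)" if "\<bar>z\<bar> \<le> total_mass \<omega>" for z \<omega>
    using that t by (auto intro!: mult_left_mono)
  show int_exp: "integrable M (\<lambda>\<omega>. exp (t * Z \<omega>))"
    using Z_abs exp_le by (intro integrable_exp_total_mass_dominated[of _ t]) auto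
  have lim1: "(\<lambda>m. expectation (Zm m)) \<longlonglongrightarrow> expectation Z"
  proof (rule integral_dominated_convergence[where w = "\<lambda>\<omega>. exp (1 * total_mass \<omega>)"])
    show "AE \<omega> in M. norm (Zm n \<omega>) \<le> exp (1 * total_mass \<omega>)" for n
      using Zm_abs total_mass_le_exp by (intro AE_I2) (auto intro: order_trans)
  qed (use Zm lim integrable_exp_total_mass[of 1] in \<open>auto intro!: AE_I2\<close>)
  have lim2: "(\<lambda>m. expectation (\<lambda>\<omega>. exp (t * Zm m \<omega>))) \<longlonglongrightarrow> expectation (\<lambda>\<omega>. exp (t * Z \<omega>))"
  proof (rule integral_dominated_convergence[where w = "\<lambda>\<omega>. exp (t * total_mass \<omega>)"])
    show "AE \<omega> in M. norm (exp (t * Zm n \<omega>)) \<le> exp (t * total_mass \<omega>)" for n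
      using Zm_abs exp_le by (intro AE_I2) auto
    show "(\<lambda>\<omega>. exp (t * Zm n \<omega>)) \<in> borel_measurable M" for n
      using Zm(1)[of n] by measurable
  qed (use lim integrable_exp_total_mass in \<open>auto intro!: AE_I2 tendsto_intros\<close>)
  have pos: "expectation (\<lambda>\<omega>. exp (t * Z \<omega>)) > 0"
    by (intro expectation_greater int_exp) auto
  have lim3: "(\<lambda>m. v + 2 / real (Suc m) * measure \<Lambda> UNIV) \<longlonglongrightarrow> v"
    using tendsto_add[OF tendsto_const const_over_Suc_times_tendsto_0, of v 2] by simp
  show "ln (expectation (\<lambda>\<omega>. exp (t * Z \<omega>)))
      \<le> t * expectation Z + t / 2 * (2 * expectation Z + v) * (exp (exp t - 1) - 1)"
  proof (rule tendsto_le[OF sequentially_bot])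
    show "(\<lambda>m. ln (expectation (\<lambda>\<omega>. exp (t * Zm m \<omega>)))) \<longlonglongrightarrow> ln (expectation (\<lambda>\<omega>. exp (t * Z \<omega>)))"
      using pos by (intro tendsto_ln lim2) simp
    show "(\<lambda>m. t * expectation (Zm m) + t / 2 * (2 * expectation (Zm m) +
        (v + 2 / real (Suc m) * measure \<Lambda> UNIV)) * (exp (exp t - 1) - 1))
      \<longlonglongrightarrow> t * expectation Z + t / 2 * (2 * expectation Z + v) * (exp (exp t - 1) - 1)"
      by (intro tendsto_add tendsto_mult tendsto_const lim1 lim3)
  qed (use Zm(2) in auto)
qed

end

section \<open>Tail bounds\<close>

text \<open>
  Taking logarithms, the claim is \<open>(exp (2 t) - 1) / 2 \<le> ln (2 - t) - ln (2 - 3 t)\<close>; both sides vanish at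
  0, and their derivatives compare because \<open>exp (2 t) (2 - t) (2 - 3 t)\<close> decreases from 4.
\<close>

lemma exp_exp_minus_one_le_rational:
  fixes t :: real
  assumes "0 \<le> t" "t < 2 / 3"
  shows "exp ((exp (2 * t) - 1) / 2) - 1 \<le> 2 * t / (2 - 3 * t)"
proof -
  define f where "f = (\<lambda>t :: real. ln (2 - t) - ln (2 - 3 * t) - (exp (2 * t) - 1) / 2)"
  have key: "exp (2 * x) * ((2 - x) * (2 - 3 * x)) \<le> 4" if "0 \<le> x" "x < 2 / 3" for x :: real
  proof -
    have "exp (2 * x) * ((2 - x) * (2 - 3 * x)) \<le> exp (2 * 0) * ((2 - 0) * (2 - 3 * (0::real)))"
    proof (rule DERIV_nonpos_imp_nonincreasing[OF that(1), where f = "\<lambda>x. exp (2 * x) * ((2 - x) * (2 - 3 * x))"])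
      fix y :: real assume y: "0 \<le> y" "y \<le> x"
      have "exp (2 * y) * (2 * y) * (3 * y - 5) \<le> 0"
        using y that by (intro mult_nonneg_nonpos) auto
      moreover have "((\<lambda>x. exp (2 * x) * ((2 - x) * (2 - 3 * x))) has_real_derivative
          exp (2 * y) * (2 * y) * (3 * y - 5)) (at y)"
        by (auto intro!: derivative_eq_intros simp: algebra_simps)
      ultimately show "\<exists>d. ((\<lambda>x. exp (2 * x) * ((2 - x) * (2 - 3 * x))) has_real_derivative d) (at y) \<and> d \<le> 0"
        by blast
    qed
    then show ?thesis
      by simp
  qed
  have "f 0 \<le> f t"
  proof (rule DERIV_nonneg_imp_nondecreasing[OF assms(1)])
    fix x assume x: "0 \<le> x" "x \<le> t"
    then have x': "x < 2 / 3"
      using assms by simp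
    have "(f has_real_derivative (3 / (2 - 3 * x) - 1 / (2 - x) - exp (2 * x))) (at x)"
      unfolding f_def using x' by (auto intro!: derivative_eq_intros)
    moreover have "0 \<le> 3 / (2 - 3 * x) - 1 / (2 - x) - exp (2 * x)"
    proof -
      have "3 / (2 - 3 * x) - 1 / (2 - x) = 4 / ((2 - x) * (2 - 3 * x))"
        using x' by (simp add: divide_simps)
      moreover have "exp (2 * x) \<le> 4 / ((2 - x) * (2 - 3 * x))"
        using key[OF x(1) x'] x' by (subst pos_le_divide_eq) auto
      ultimately show ?thesis
        by simp
    qed
    ultimately show "\<exists>d. (f has_real_derivative d) (at x) \<and> 0 \<le> d"
      by blast
  qed
  then have "(exp (2 * t) - 1) / 2 \<le> ln ((2 - t) / (2 - 3 * t))"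
    using assms by (simp add: f_def ln_div)
  then have "exp ((exp (2 * t) - 1) / 2) \<le> (2 - t) / (2 - 3 * t)"
    using assms by (subst (asm) ln_ge_iff) auto
  also have "\<dots> = 1 + 2 * t / (2 - 3 * t)"
    using assms by (simp add: field_simps)
  finally show ?thesis
    by simp
qed

text \<open>
  The choice of \<open>t\<close> in the Chernoff bound. For the first estimate \<open>t\<close> solves
  \<open>exp ((exp (2 t) - 1) / 2) - 1 = x / u\<close>. For the second one, the exponent is at most
  \<open>u t\<^sup>2 / (2 - 3 t) - t x\<close>, which is minimal at \<open>t = 2 / 3 (1 - 1 / w)\<close> with \<open>w = sqrt (1 + 3 x / u)\<close>.
  For \<open>u = 0\<close> the divisions by \<open>u\<close> yield 0, so the first estimate is trivial; in the second one \<open>t = 2 / 3\<close>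
  is used.
\<close>

lemma exponential_tail_optimization:
  fixes p u x :: real
  assumes u: "0 \<le> u" and x: "0 \<le> x"
    and tail: "\<And>t. 0 \<le> t \<Longrightarrow> p \<le> exp (t / 2 * u * (exp ((exp (2 * t) - 1) / 2) - 1) - t * x)"
  shows "p \<le> exp (- (x / 4) * ln (1 + 2 * ln (1 + x / u)))"
    and "p \<le> exp (- (x\<^sup>2 / (u + sqrt (u\<^sup>2 + 3 * u * x) + 3 * x / 2)))"
proof -
  show "p \<le> exp (- (x / 4) * ln (1 + 2 * ln (1 + x / u)))"
  proof (cases "u = 0")
    case True
    then show ?thesis
      using tail[of 0] by simp
  next
    case False
    then have u: "u > 0"
      using u by simp
    define l where "l = ln (1 + x / u)"
    define t where "t = ln (1 + 2 * l) / 2"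
    have l: "l \<ge> 0"
      unfolding l_def using x u by (intro ln_ge_zero) simp
    then have t: "t \<ge> 0"
      by (simp add: t_def)
    have "exp (2 * t) = 1 + 2 * l"
      using l by (simp add: t_def)
    moreover have "exp l = 1 + x / u"
      using x u by (simp add: l_def add_pos_nonneg)
    ultimately have "t / 2 * u * (exp ((exp (2 * t) - 1) / 2) - 1) - t * x = - (x / 4) * ln (1 + 2 * l)"
      using u by (simp add: t_def)
    then show ?thesis
      using tail[OF t] by (simp add: l_def)
  qed
  show "p \<le> exp (- (x\<^sup>2 / (u + sqrt (u\<^sup>2 + 3 * u * x) + 3 * x / 2)))"
  proof (cases "u = 0")
    case True
    have "x\<^sup>2 / (3 * x / 2) = 2 / 3 * x"
      by (simp add: power2_eq_square)
    then have rate: "x\<^sup>2 / (u + sqrt (u\<^sup>2 + 3 * u * x) + 3 * x / 2) = 2 / 3 * x"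
      using True by (simp only: power2_eq_square mult_zero_left mult_zero_right add_0 real_sqrt_zero)
    have "p \<le> exp (- (2 / 3 * x))"
      using tail[of "2 / 3"] True by simp
    then show ?thesis
      unfolding rate .
  next
    case False
    then have u: "u > 0"
      using u by simp
    define w where "w = sqrt (1 + 3 * x / u)"
    have w2: "w\<^sup>2 = 1 + 3 * x / u"
      unfolding w_def using x u by simp
    have w1: "w \<ge> 1"
      unfolding w_def using x u by simp
    have x_eq: "x = u * (w\<^sup>2 - 1) / 3"
      using u by (simp add: w2)
    have "sqrt (u\<^sup>2 + 3 * u * x) = sqrt (u\<^sup>2 * w\<^sup>2)"
      unfolding w2 using u by (simp add: algebra_simps power2_eq_square)
    also have "\<dots> = u * w"
      using u w1 by (simp add: real_sqrt_mult)
    finally have root: "sqrt (u\<^sup>2 + 3 * u * x) = u * w" .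
    have denominator: "u + u * w + 3 * x / 2 = u * (w + 1)\<^sup>2 / 2"
      unfolding x_eq by (simp add: power2_eq_square field_simps)
    have "x\<^sup>2 = (u * (w + 1)\<^sup>2 / 2) * (2 * u * (w - 1)\<^sup>2 / 9)"
      unfolding x_eq by (simp add: power2_eq_square field_simps)
    moreover have "u * (w + 1)\<^sup>2 / 2 \<noteq> 0"
      using u w1 by simp
    ultimately have rate: "x\<^sup>2 / (u + sqrt (u\<^sup>2 + 3 * u * x) + 3 * x / 2) = 2 * u * (w - 1)\<^sup>2 / 9"
      unfolding root denominator by (metis nonzero_mult_div_cancel_left)
    define t where "t = 2 / 3 * (1 - 1 / w)"
    have t: "0 \<le> t" "t < 2 / 3"
      using w1 by (simp_all add: t_def field_simps)
    have "t / 2 * u * (exp ((exp (2 * t) - 1) / 2) - 1) \<le> t / 2 * u * (2 * t / (2 - 3 * t))"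
      using t u by (intro mult_left_mono exp_exp_minus_one_le_rational) auto
    also have "2 * t / (2 - 3 * t) = 2 / 3 * (w - 1)"
      using w1 by (simp add: t_def field_simps)
    also have "t / 2 * u * (2 / 3 * (w - 1)) - t * x = - (2 * u * (w - 1)\<^sup>2 / 9)"
      using w1 unfolding t_def x_eq by (simp add: power2_eq_square field_simps)
    finally have "t / 2 * u * (exp ((exp (2 * t) - 1) / 2) - 1) - t * x \<le> - (2 * u * (w - 1)\<^sup>2 / 9)"
      by simp
    then show ?thesis
      using tail[OF t(1)] unfolding rate by (meson exp_le_cancel_iff order_trans)
  qed
qed

lemma bernstein_rate_le:
  fixes u x :: real
  assumes u: "0 \<le> u" and x: "0 \<le> x"
  shows "x\<^sup>2 / (2 * u + 3 * x) \<le> x\<^sup>2 / (u + sqrt (u\<^sup>2 + 3 * u * x) + 3 * x / 2)"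
proof (cases "u = 0 \<and> x = 0")
  case False
  have "sqrt (u\<^sup>2 + 3 * u * x) \<le> u + 3 * x / 2"
    using u x by (intro real_le_lsqrt) (auto simp: power2_eq_square algebra_simps)
  moreover have "0 < u + sqrt (u\<^sup>2 + 3 * u * x) + 3 * x / 2"
  proof (cases "u = 0")
    case True
    with False x show ?thesis
      by simp
  next
    case False
    with u x show ?thesis
      by (intro add_pos_nonneg) auto
  qed
  ultimately show ?thesis
    by (intro divide_left_mono) auto
qed auto

section \<open>Concentration of the supremum\<close>

text \<open>
  The preceding results give the first bound with \<open>exp t - 1\<close> in place of \<open>(exp (2 t) - 1) / 2\<close>, and
  \<open>(exp t - 1)\<^sup>2 \<ge> 0\<close> shows that the former is the smaller one. The replacement relies on \<open>\<upsilon> \<ge> 0\<close>;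
  the mean of the supremum is nonnegative since each compensated integral is centred.
\<close>

theorem theorem2p1:
  fixes M :: "'w measure"
    and \<Lambda> :: "'x :: polish_space measure"
    and N :: "'w \<Rightarrow> 'x measure"
    and S :: "('x \<Rightarrow> real) set"
    and I :: "('x \<Rightarrow> real) \<Rightarrow> 'w \<Rightarrow> real"
    and Z :: "'w \<Rightarrow> real"
    and EZ V \<upsilon> :: real
    and L\<^sub>Z :: "real \<Rightarrow> real"
  assumes "finite_poisson_point_process M \<Lambda> N"
    and "countable S" and "S \<noteq> {}"
    and "\<And>s. s \<in> S \<Longrightarrow> s \<in> borel_measurable borel"
    and "\<And>s x. s \<in> S \<Longrightarrow> s x \<in> {-1..1}"
  defines "I \<equiv> compensated_integral \<Lambda> N"
    and "Z \<equiv> (\<lambda>\<omega>. SUP s\<in>S. I s \<omega>)"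
    and "EZ \<equiv> prob_space.expectation M Z"
    and "L\<^sub>Z \<equiv> (\<lambda>t. ln (prob_space.expectation M (\<lambda>\<omega>. exp (t * Z \<omega>))))"
    and "V \<equiv> (SUP s\<in>S. prob_space.variance M (I s))"
    and "\<upsilon> \<equiv> 2 * EZ + V"
  shows "(\<forall>t\<ge>0. L\<^sub>Z t \<le> t * EZ + t / 2 * (2 * EZ + V) * (exp ((exp (2 * t) - 1) / 2) - 1)) \<and>
    (\<forall>x\<ge>0. \<P>(\<omega> in M. Z \<omega> \<ge> EZ + x) \<le> exp (- (x / 4) * ln (1 + 2 * ln (1 + x / \<upsilon>)))) \<and>
    (\<forall>x\<ge>0. \<P>(\<omega> in M. Z \<omega> \<ge> EZ + x) \<le> exp (- (x\<^sup>2 / (\<upsilon> + sqrt (\<upsilon>\<^sup>2 + 3 * \<upsilon> * x) + 3 * x / 2))) \<and>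
      exp (- (x\<^sup>2 / (\<upsilon> + sqrt (\<upsilon>\<^sup>2 + 3 * \<upsilon> * x) + 3 * x / 2))) \<le> exp (- (x\<^sup>2 / (2 * \<upsilon> + 3 * x))))"
proof -
  interpret finite_poisson_point_process M \<Lambda> N
    by fact
  have S_meas: "s \<in> borel_measurable borel" and S_abs: "\<bar>s x\<bar> \<le> 1" if "s \<in> S" for s x
    using assms(4)[OF that] assms(5)[OF that, of x] by (auto simp: abs_le_iff)
  \<comment> \<open>An enumeration of \<open>S\<close>, with repetitions if \<open>S\<close> is finite.\<close>
  define e where "e = from_nat_into S"
  have e: "e i \<in> S" for i
    unfolding e_def by (intro from_nat_into assms)
  have range_e: "range e = S"
    unfolding e_def by (intro range_from_nat_into assms)
  have Z_eq: "Z = (\<lambda>\<omega>. SUP i. compensated_integral \<Lambda> N (e i) \<omega>)"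
    unfolding Z_def I_def range_e[symmetric] by (simp add: image_image)
  have variance: "variance (I s) = (\<integral>x. (s x)\<^sup>2 \<partial>\<Lambda>)" if "s \<in> S" for s
    unfolding I_def using compensated_integral_moments[OF S_meas[OF that] S_abs[OF that]] by simp
  have "(\<integral>x. (s x)\<^sup>2 \<partial>\<Lambda>) \<le> (\<integral>x. 1 \<partial>\<Lambda>)" if "s \<in> S" for s
  proof (rule integral_mono)
    have "(\<lambda>x. (s x)\<^sup>2) \<in> borel_measurable \<Lambda>"
      using S_meas[OF that] by (simp add: measurable_cong_sets[OF sets_intensity refl])
    then show "integrable \<Lambda> (\<lambda>x. (s x)\<^sup>2)"
      using S_abs[OF that] by (intro intensity.integrable_const_bound[where B = 1]) (auto simp: abs_square_le_1)
  qed (use S_abs[OF that] in \<open>auto simp: abs_square_le_1\<close>)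
  then have bdd: "bdd_above ((\<lambda>s. variance (I s)) ` S)"
    by (intro bdd_aboveI2[where M = "\<integral>x. 1 \<partial>\<Lambda>"]) (simp only: variance)
  have V: "(\<integral>x. (s x)\<^sup>2 \<partial>\<Lambda>) \<le> V" if "s \<in> S" for s
    unfolding V_def variance[OF that, symmetric] by (rule cSUP_upper[OF that bdd])
  have main: "L\<^sub>Z t \<le> t * EZ + t / 2 * \<upsilon> * (exp (exp t - 1) - 1)"
    and intZ: "integrable M Z" and int_exp: "integrable M (\<lambda>\<omega>. exp (t * Z \<omega>))"
    if "t \<ge> 0" for t
    using ln_mgf_sup_compensated_integral_le[of e V t, OF S_meas[OF e] S_abs[OF e] V[OF e] that]
    unfolding L\<^sub>Z_def EZ_def Z_eq \<upsilon>_def by blast+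
  have Z_ge: "I (e 0) \<omega> \<le> Z \<omega>" if "\<omega> \<in> space M" for \<omega>
    unfolding Z_eq I_def using abs_compensated_integral_le[OF that S_meas[OF e] S_abs[OF e]]
    by (intro cSUP_upper bdd_aboveI2[where M = "total_mass \<omega>"]) (auto simp: abs_le_iff)
  have "integrable M (I (e 0))"
    unfolding I_def
    using compensated_integral_moments(1)[OF S_meas[OF e] S_abs[OF e]]
      abs_compensated_integral_le[OF _ S_meas[OF e] S_abs[OF e]] total_mass_le_exp order_trans
    by (intro integrable_exp_total_mass_dominated[of _ 1]) blast+
  then have "expectation (I (e 0)) \<le> EZ"
    unfolding EZ_def using Z_ge intZ by (intro integral_mono) auto
  then have EZ: "0 \<le> EZ"
    using compensated_integral_moments(2)[OF S_meas[OF e] S_abs[OF e]] by (simp add: I_def)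
  have "0 \<le> V"
    using V[OF e[of 0]] by (rule order_trans[rotated]) simp
  with EZ have \<upsilon>: "0 \<le> \<upsilon>"
    by (simp add: \<upsilon>_def)
  have a: "L\<^sub>Z t \<le> t * EZ + t / 2 * \<upsilon> * (exp ((exp (2 * t) - 1) / 2) - 1)" if t: "t \<ge> 0" for t
  proof -
    have "0 \<le> (exp t - 1)\<^sup>2"
      by simp
    also have "(exp t - 1)\<^sup>2 = exp (2 * t) - 2 * exp t + 1"
      by (simp add: power2_eq_square algebra_simps flip: exp_add)
    finally have "exp t - 1 \<le> (exp (2 * t) - 1) / 2"
      by (simp add: field_simps)
    then have "t / 2 * \<upsilon> * (exp (exp t - 1) - 1) \<le> t / 2 * \<upsilon> * (exp ((exp (2 * t) - 1) / 2) - 1)"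
      using t \<upsilon> by (intro mult_left_mono) auto
    then show ?thesis
      using main[OF t] by linarith
  qed
  have tail: "\<P>(\<omega> in M. Z \<omega> \<ge> EZ + x) \<le>
      exp (t / 2 * \<upsilon> * (exp ((exp (2 * t) - 1) / 2) - 1) - t * x)" if t: "t \<ge> 0" for t x
  proof -
    have "\<P>(\<omega> in M. Z \<omega> \<ge> EZ + x) \<le> prob {\<omega> \<in> space M. exp (t * Z \<omega>) \<ge> exp (t * (EZ + x))}"
    proof (rule finite_measure_mono)
      have [measurable]: "(\<lambda>\<omega>. exp (t * Z \<omega>)) \<in> borel_measurable M"
        using int_exp[OF t] by (rule borel_measurable_integrable)
      show "{\<omega> \<in> space M. exp (t * Z \<omega>) \<ge> exp (t * (EZ + x))} \<in> events"
        by measurable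
    qed (use t in \<open>auto intro!: mult_left_mono\<close>)
    also have "\<dots> \<le> expectation (\<lambda>\<omega>. exp (t * Z \<omega>)) / exp (t * (EZ + x))"
      using int_exp[OF t] by (intro integral_Markov_inequality_measure[where A = "{}"]) auto
    also have "\<dots> = exp (L\<^sub>Z t - t * (EZ + x))"
    proof -
      have "0 < expectation (\<lambda>\<omega>. exp (t * Z \<omega>))"
        by (intro expectation_greater int_exp t) auto
      then show ?thesis
        by (simp add: L\<^sub>Z_def exp_diff)
    qed
    also have "\<dots> \<le> exp (t / 2 * \<upsilon> * (exp ((exp (2 * t) - 1) / 2) - 1) - t * x)"
      using a[OF t] by (simp add: algebra_simps)
    finally show ?thesis .
  qed
  show ?thesis
    using a exponential_tail_optimization[OF \<upsilon> _ tail] bernstein_rate_le[OF \<upsilon>]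
    by (auto simp flip: \<upsilon>_def)
qed

end
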